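(* For $|q|<1$, $$\mathrm{C}\Phi_6(q)=\frac49\frac{(q;q)_\infty^5(q^4;q^4)_\infty^2}{(q^2;q^2)_\infty^5(q^3;q^3)_\infty^3}-\frac13\frac{(q^2;q^2)_\infty^4(q^4;q^4)_\infty^2}{(q;q)_\infty^4(q^6;q^6)_\infty^3}+\frac89\frac{(q^4;q^4)_\infty^{11}}{(q;q)_\infty^4(q^2;q^2)_\infty^5(q^{12};q^{12})_\infty^3}$$ $$+36q\frac{(q^4;q^4)_\infty^2(q^3;q^3)_\infty^9}{(q;q)_\infty^7(q^2;q^2)_\infty^5}+27q^2\frac{(q^4;q^4)_\infty^2(q^6;q^6)_\infty^9}{(q;q)_\infty^4(q^2;q^2)_\infty^8}+72q^4\frac{(q^{12};q^{12})_\infty^9}{(q;q)_\infty^4(q^2;q^2)_\infty^5(q^4;q^4)_\infty}.$$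
   Context: A $k$-colored generalized Frobenius symbol is a two-row array with $d\ge 0$ columns whose entries are colored nonnegative integers $\ell_c$ ($\ell\ge 0$, color $c\in\{1,\dots,k\}$), each row strictly decreasing with respect to the total order $0_1\prec 0_2\prec\cdots\prec 0_k\prec 1_1\prec\cdots\prec 1_k\prec 2_1\prec\cdots$. It is a $k$-colored generalized Frobenius partition of $n=d+\sum(\text{integer values of all entries})$. $c\phi_k(n)$ is the number of such partitions of $n$ (with $c\phi_k(0)=1$), and $\mathrm{C}\Phi_k(q)=\sum_{n\ge0}c\phi_k(n)q^n$. $(a;q)_\infty=\prod_{j\ge1}(1-aq^{j-1})$. *)

theory Defs
  imports "HOL-Analysis.Analysis"
begin

text \<open>The pair \<open>(l, c)\<close> encodes the integer \<open>l\<close> in color \<open>c\<close>.\<close>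

definition colored_less :: "nat \<times> nat \<Rightarrow> nat \<times> nat \<Rightarrow> bool" where
  "colored_less x y \<longleftrightarrow> fst x < fst y \<or> (fst x = fst y \<and> snd x < snd y)"

definition frobenius_row :: "nat \<Rightarrow> (nat \<times> nat) list \<Rightarrow> bool" where
  "frobenius_row k r \<longleftrightarrow>
     (\<forall>x \<in> set r. snd x \<in> {1..k}) \<and> sorted_wrt (\<lambda>x y. colored_less y x) r"

text \<open>A symbol is the pair of its rows, each read from left to right.\<close>

definition frobenius_symbol :: "nat \<Rightarrow> (nat \<times> nat) list \<times> (nat \<times> nat) list \<Rightarrow> bool" where
  "frobenius_symbol k s \<longleftrightarrow>
     length (fst s) = length (snd s) \<and> frobenius_row k (fst s) \<and> frobenius_row k (snd s)"

definition frobenius_weight :: "(nat \<times> nat) list \<times> (nat \<times> nat) list \<Rightarrow> nat" where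
  "frobenius_weight s =
     length (fst s) + sum_list (map fst (fst s)) + sum_list (map fst (snd s))"

definition frobenius_partitions :: "nat \<Rightarrow> nat \<Rightarrow> ((nat \<times> nat) list \<times> (nat \<times> nat) list) set" where
  "frobenius_partitions k n = {s. frobenius_symbol k s \<and> frobenius_weight s = n}"

definition cphi :: "nat \<Rightarrow> nat \<Rightarrow> nat" where
  "cphi k n = card (frobenius_partitions k n)"

definition CPhi :: "nat \<Rightarrow> complex \<Rightarrow> complex" where
  "CPhi k q = (\<Sum>n. of_nat (cphi k n) * q ^ n)"

definition qpochhammer_inf :: "complex \<Rightarrow> complex \<Rightarrow> complex" where
  "qpochhammer_inf a q = (\<Prod>j. 1 - a * q ^ j)"

abbreviation euler_prod :: "complex \<Rightarrow> complex" where
  "euler_prod q \<equiv> qpochhammer_inf q q"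

text \<open>Finiteness ensures that the cardinality defining \<open>cphi\<close> is a genuine count.\<close>

lemma finite_frobenius_partitions: "finite (frobenius_partitions k n)"
proof (rule finite_subset)
  let ?L = "{r. set r \<subseteq> {0..n} \<times> {1..k} \<and> length r \<le> n}"
  show "finite (?L \<times> ?L)"
    by (intro finite_cartesian_product finite_lists_length_le) auto
  have mem: "fst x \<le> sum_list (map fst r)" if "x \<in> set r" for x and r :: "(nat \<times> nat) list"
    using that by (intro member_le_sum_list) auto
  show "frobenius_partitions k n \<subseteq> ?L \<times> ?L"
    unfolding frobenius_partitions_def frobenius_symbol_def frobenius_row_def
      frobenius_weight_def
    by (fastforce dest: mem)
qed

lemma cphi_0: "cphi k 0 = 1"
proof -
  have "frobenius_partitions k 0 = {([], [])}"
    by (auto simp: frobenius_partitions_def frobenius_symbol_def frobenius_row_def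
        frobenius_weight_def)
  then show ?thesis by (simp add: cphi_def)
qed

end

theory Submission
  imports Defs
begin

text \<open>
  Write \<open>E\<^sub>n = (q\<^sup>n; q\<^sup>n)\<^sub>\<infinity>\<close>. The two rows of a symbol are finite sets of coloured integers, so \<open>C\<Phi>\<^sub>6\<close> is the
  constant term in \<open>z\<close> of a product, which by the Jacobi triple product is the sixth power of
  \<open>\<Sum> q\<^bsup>m(m+1)/2\<^esup> z\<^sup>m\<close>, divided by \<open>E\<^sub>1\<^sup>6\<close>. Writing the sixth power as a product of two cubes gives
  \<open>E\<^sub>1\<^sup>6 C\<Phi>\<^sub>6 = \<phi>(q\<^sup>3) a(q)\<^sup>2 + 2 q L(q)\<^sup>2 \<Sum> q\<^bsup>3s(s+1)-s\<^esup>\<close>, where \<open>a\<close> is the theta series of the hexagonal lattice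
  and \<open>L = 3 E\<^sub>3\<^sup>3 / E\<^sub>1\<close> that of a coset.

  Put \<open>C = E\<^sub>4\<^sup>3 / E\<^sub>1\<^sub>2\<close> and \<open>D = q E\<^sub>2\<^sup>2 E\<^sub>1\<^sub>2\<^sup>3 / (E\<^sub>4 E\<^sub>6\<^sup>2)\<close>. Splitting \<open>L\<close> by parity gives
  \<open>E\<^sub>3\<^sup>3 / E\<^sub>1 = (E\<^sub>6\<^sup>2 / E\<^sub>2\<^sup>2) (C + D)\<close>. Together with its version at \<open>-q\<close>, Legendre's relation
  \<open>\<phi>(q) \<phi>(q\<^sup>3) - \<phi>(-q) \<phi>(-q\<^sup>3) = 4 q \<psi>(q\<^sup>2) \<psi>(q\<^sup>6)\<close> and Jacobi's quartic identity at \<open>q\<^sup>3\<close>, this is a linear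
  system that forces \<open>E\<^sub>1\<^sup>3 / E\<^sub>3 = C - 3 D\<close>. After multiplication by \<open>\<phi>(q)\<close> both sides of the theorem are
  rational functions of \<open>C\<close> and \<open>D\<close>, and they agree.
\<close>

section \<open>Infinite sums\<close>

text \<open>Over the complex numbers every summable family is absolutely summable, so the norms can
  be summed first over \<open>B\<close> and then over \<open>A\<close>. This supplies the joint
  summability that the Fubini rule for \<open>has_sum\<close> requires.\<close>

lemma has_sum_times_complex:
  fixes f :: "'a \<Rightarrow> complex" and g :: "'b \<Rightarrow> complex"
  assumes f: "(f has_sum a) A" and g: "(g has_sum b) B"
  shows "((\<lambda>(x, y). f x * g y) has_sum a * b) (A \<times> B)"
proof (rule has_sum_SigmaI)
  show "((\<lambda>y. case (x, y) of (x, y) \<Rightarrow> f x * g y) has_sum f x * b) B" for x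
    using has_sum_cmult_right[OF g, of "f x"] by simp
  show "((\<lambda>x. f x * b) has_sum a * b) A"
    using has_sum_cmult_left[OF f, of b] by simp
  have nf: "(\<lambda>x. norm (f x)) summable_on A" and ng: "(\<lambda>x. norm (g x)) summable_on B"
    using f g by (auto dest: has_sum_imp_summable simp: summable_on_iff_abs_summable_on_complex)
  have "(\<lambda>p. norm ((\<lambda>(x, y). f x * g y) p)) summable_on A \<times> B"
  proof (subst Infinite_Sum.abs_summable_on_Sigma_iff, intro conjI ballI)
    show "(\<lambda>y. norm (case (x, y) of (x, y) \<Rightarrow> f x * g y)) summable_on B" for x
      using ng by (simp add: norm_mult summable_on_cmult_right)
    show "(\<lambda>x. norm (infsum (\<lambda>y. norm (case (x, y) of (x, y) \<Rightarrow> f x * g y)) B)) summable_on A"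
      using nf by (simp add: norm_mult infsum_cmult_right' infsum_nonneg abs_mult summable_on_cmult_left)
  qed
  then show "(\<lambda>(x, y). f x * g y) summable_on A \<times> B"
    by (rule abs_summable_summable)
qed

lemma has_sum_sum_finite:
  fixes f :: "'i \<Rightarrow> 'a \<Rightarrow> complex"
  assumes "finite I" "\<And>i. i \<in> I \<Longrightarrow> (f i has_sum a i) A"
  shows "((\<lambda>x. \<Sum>i\<in>I. f i x) has_sum (\<Sum>i\<in>I. a i)) A"
  using assms by (induction rule: finite_induct) (auto intro!: has_sum_add)

text \<open>Dominated convergence for the counting measure, reached through
  \<open>infsetsum\<close>, which is a Lebesgue integral. The bound \<open>h\<close> is complex, so
  that an already known series can serve as the dominating one.\<close>

lemma tendsto_infsum_dominated:
  fixes f :: "nat \<Rightarrow> 'a \<Rightarrow> complex"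
  assumes lim: "\<And>x. x \<in> A \<Longrightarrow> (\<lambda>n. f n x) \<longlonglongrightarrow> g x"
    and bound: "\<And>n x. x \<in> A \<Longrightarrow> norm (f n x) \<le> norm (h x)"
    and h: "(h :: 'a \<Rightarrow> complex) summable_on A"
  shows "(\<lambda>n. infsum (f n) A) \<longlonglongrightarrow> infsum g A"
proof -
  have nh: "Infinite_Set_Sum.abs_summable_on h A"
    using h by (simp add: summable_on_iff_abs_summable_on_complex flip: abs_summable_equivalent)
  have gb: "norm (g x) \<le> norm (h x)" if "x \<in> A" for x
    using lim[OF that] bound[OF that] by (intro Lim_norm_ubound[of sequentially "\<lambda>n. f n x"]) auto
  have fs: "Infinite_Set_Sum.abs_summable_on (f n) A" for n
    using abs_summable_on_comparison_test[OF nh bound] .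
  have gs: "Infinite_Set_Sum.abs_summable_on g A"
    using abs_summable_on_comparison_test[OF nh gb] .
  have "(\<lambda>n. infsetsum (f n) A) \<longlonglongrightarrow> infsetsum g A"
    unfolding infsetsum_def
  proof (rule integral_dominated_convergence[where w = "\<lambda>x. norm (h x)"])
    show "integrable (count_space A) (\<lambda>x. norm (h x))"
      using nh unfolding Infinite_Set_Sum.abs_summable_on_def by (rule integrable_norm)
  qed (use lim bound in \<open>auto simp: AE_count_space\<close>)
  then show ?thesis
    by (simp add: infsetsum_infsum fs gs)
qed

text \<open>An increasing exhaustion by finite sets is cofinal among the finite subsets, so an
  unordered sum can be evaluated along it.\<close>

lemma filterlim_finite_subsets_at_top_incseq:
  assumes "incseq A" "\<And>n. finite (A n)" "(\<Union>n. A n) = S"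
  shows "filterlim A (finite_subsets_at_top S) sequentially"
  unfolding filterlim_finite_subsets_at_top
proof (intro allI impI)
  fix X assume X: "finite X \<and> X \<subseteq> S"
  then have "\<forall>x\<in>X. \<exists>n. x \<in> A n" using assms(3) by blast
  then obtain k where k: "\<And>x. x \<in> X \<Longrightarrow> x \<in> A (k x)" by metis
  have "X \<subseteq> A n" if "n \<ge> Max (insert 0 (k ` X))" for n
  proof
    fix x assume x: "x \<in> X"
    then have "k x \<le> n" using that X by auto
    then show "x \<in> A n" using k[OF x] assms(1) by (auto simp: incseq_def)
  qed
  then show "\<forall>\<^sub>F n in sequentially. finite (A n) \<and> X \<subseteq> A n \<and> A n \<subseteq> S"
    using assms(2,3) by (auto simp: eventually_at_top_linorder intro!: exI[of _ "Max (insert 0 (k ` X))"])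
qed

lemma prod_one_plus_eq_sum_Pow:
  fixes x :: "'a \<Rightarrow> 'b :: comm_ring_1"
  assumes "finite A"
  shows "(\<Prod>i\<in>A. 1 + x i) = (\<Sum>X\<in>Pow A. \<Prod>i\<in>X. x i)"
  using prod_add[OF assms, of x "\<lambda>_. 1"] by (simp add: add.commute)

text \<open>Expansion of an infinite product over finite index sets. A finite family
  \<open>F\<close> of such sets lies in the power set of its union, which bounds its absolute sum by
  a finite product and hence by the exponential of the norm sum. The value is then the limit along
  the power sets of \<open>A n\<close>, whose sums are the partial products.\<close>

lemma has_sum_Fpow_prod:
  fixes x :: "'a \<Rightarrow> complex"
  assumes x: "x summable_on I"
    and A: "incseq A" "\<And>n. finite (A n)" "(\<Union>n. A n) = I"
    and lim: "(\<lambda>n. \<Prod>i\<in>A n. 1 + x i) \<longlonglongrightarrow> P"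
  shows "((\<lambda>X. \<Prod>i\<in>X. x i) has_sum P) (Fpow I)"
proof -
  have nx: "(\<lambda>i. norm (x i)) summable_on I"
    using x by (simp add: summable_on_iff_abs_summable_on_complex)
  let ?e = "exp (infsum (\<lambda>i. norm (x i)) I)"
  have "(\<lambda>X. norm (\<Prod>i\<in>X. x i)) summable_on Fpow I"
  proof (rule nonneg_bdd_above_summable_on)
    show "bdd_above (sum (\<lambda>X. norm (\<Prod>i\<in>X. x i)) ` {F. F \<subseteq> Fpow I \<and> finite F})"
    proof (rule bdd_aboveI2[where M = ?e])
      fix F assume F: "F \<in> {F. F \<subseteq> Fpow I \<and> finite F}"
      then have U: "finite (\<Union>F)" "\<Union>F \<subseteq> I" "F \<subseteq> Pow (\<Union>F)" by (auto simp: Fpow_def)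
      have "(\<Sum>X\<in>F. norm (\<Prod>i\<in>X. x i)) = (\<Sum>X\<in>F. \<Prod>i\<in>X. norm (x i))"
        by (simp add: prod_norm)
      also have "\<dots> \<le> (\<Sum>X\<in>Pow (\<Union>F). \<Prod>i\<in>X. norm (x i))"
        using U by (intro sum_mono2) (auto intro: prod_nonneg)
      also have "\<dots> = (\<Prod>i\<in>\<Union>F. 1 + norm (x i))"
        using U by (simp add: prod_one_plus_eq_sum_Pow)
      also have "\<dots> \<le> exp (\<Sum>i\<in>\<Union>F. norm (x i))"
        using prod_le_exp_sum[of "\<Union>F" "\<lambda>i. norm (x i)"] by simp
      also have "\<dots> \<le> ?e"
        using finite_sum_le_infsum[OF nx U(1,2)] by simp
      finally show "(\<Sum>X\<in>F. norm (\<Prod>i\<in>X. x i)) \<le> ?e" .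
    qed
  qed auto
  then have "(\<lambda>X. \<Prod>i\<in>X. x i) summable_on Fpow I"
    by (rule abs_summable_summable)
  then have hs: "((\<lambda>X. \<Prod>i\<in>X. x i) has_sum infsum (\<lambda>X. \<Prod>i\<in>X. x i) (Fpow I)) (Fpow I)"
    by simp
  have "filterlim (\<lambda>n. Pow (A n)) (finite_subsets_at_top (Fpow I)) sequentially"
  proof (rule filterlim_finite_subsets_at_top_incseq)
    show "incseq (\<lambda>n. Pow (A n))" using A(1) by (auto simp: incseq_def)
    show "(\<Union>n. Pow (A n)) = Fpow I"
    proof (intro equalityI subsetI)
      fix X assume "X \<in> Fpow I"
      then have "finite X" "X \<subseteq> I" by (auto simp: Fpow_def)
      then have "\<forall>\<^sub>F n in sequentially. X \<subseteq> A n"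
        using filterlim_finite_subsets_at_top_incseq[OF A]
        unfolding filterlim_finite_subsets_at_top by (fast elim: eventually_mono)
      then show "X \<in> (\<Union>n. Pow (A n))" by (auto simp: eventually_at_top_linorder)
    qed (use A in \<open>auto simp: Fpow_def intro: finite_subset\<close>)
  qed (use A in auto)
  from filterlim_compose[OF hs[unfolded has_sum_def] this]
  have "(\<lambda>n. \<Prod>i\<in>A n. 1 + x i) \<longlonglongrightarrow> infsum (\<lambda>X. \<Prod>i\<in>X. x i) (Fpow I)"
    using A(2) by (simp add: prod_one_plus_eq_sum_Pow)
  then show ?thesis using hs LIMSEQ_unique[OF lim] by metis
qed

text \<open>Averaging over the roots of unity of order \<open>N\<close> keeps only the terms whose degree is divisible
  by \<open>N\<close>; as \<open>N\<close> grows, only degree \<open>0\<close> survives.\<close>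

lemma root_unity_average_tendsto:
  fixes w :: "'a \<Rightarrow> complex" and d :: "'a \<Rightarrow> int" and f :: "complex \<Rightarrow> complex"
  assumes f: "\<And>z. norm z = 1 \<Longrightarrow> ((\<lambda>s. w s * z powi d s) has_sum f z) S"
  shows "(\<lambda>N. (\<Sum>k<Suc N. f (cis (2 * pi * k / Suc N))) / Suc N) \<longlonglongrightarrow> infsum w {s \<in> S. d s = 0}"
proof -
  let ?z = "\<lambda>N k :: nat. cis (2 * pi * k / Suc N)"
  let ?a = "\<lambda>N s. (\<Sum>k<Suc N. ?z N k powi d s) / Suc N"
  have w: "w summable_on S" using f[of 1] by (auto dest: has_sum_imp_summable)
  have a_norm: "norm (?a N s) \<le> 1" for N s
  proof -
    have "norm (\<Sum>k<Suc N. ?z N k powi d s) \<le> (\<Sum>k<Suc N. norm (?z N k powi d s))"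
      by (rule norm_sum)
    also have "\<dots> = real (Suc N)" by (simp add: norm_power_int)
    finally show ?thesis
      by (simp add: norm_divide divide_le_eq del: of_nat_Suc sum.lessThan_Suc)
  qed
  \<comment> \<open>A nonzero \<open>d s\<close> of absolute value below \<open>Suc N\<close> is no
    multiple of \<open>Suc N\<close>. Hence \<open>?\<zeta>\<close> is a root of unity other than 1,
    and its geometric sum vanishes.\<close>
  have a_zero: "?a N s = 0" if "d s \<noteq> 0" "N > nat \<bar>d s\<bar>" for N s
  proof -
    let ?\<zeta> = "cis (2 * pi * d s / Suc N)"
    have pw: "?z N k powi d s = ?\<zeta> ^ k" for k
      by (simp add: cis_power_int Complex.DeMoivre algebra_simps)
    have "?\<zeta> \<noteq> 1"
    proof
      assume "?\<zeta> = 1"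
      then have "cos (2 * pi * d s / Suc N) = 1" by (simp add: complex_eq_iff)
      then obtain n :: int where n: "2 * pi * d s / Suc N = of_int n * 2 * pi"
        unfolding cos_one_2pi_int by blast
      then have "pi * of_int (d s) = pi * (of_int (n * int (Suc N)) :: real)"
        by (simp add: field_simps)
      then have "of_int (d s) = (of_int (n * int (Suc N)) :: real)"
        by (simp only: mult_left_cancel[OF pi_neq_zero])
      then have e: "d s = n * int (Suc N)" by (simp only: of_int_eq_iff)
      then have "n \<noteq> 0" using that by auto
      then have "int (Suc N) \<le> \<bar>d s\<bar>" unfolding e abs_mult by (simp add: mult_le_cancel_right1)
      then show False using that by auto
    qed
    moreover have "?\<zeta> ^ Suc N = 1"
    proof -
      have "?\<zeta> ^ Suc N = cis (2 * pi * of_int (d s))"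
        by (simp add: Complex.DeMoivre del: power_Suc)
      then show ?thesis by (simp add: cis_multiple_2pi)
    qed
    ultimately have "(\<Sum>k<Suc N. ?\<zeta> ^ k) = 0" by (simp add: sum_gp_strict del: sum.lessThan_Suc power_Suc)
    then show ?thesis unfolding pw by simp
  qed
  have "(\<lambda>N. infsum (\<lambda>s. ?a N s * w s) S) \<longlonglongrightarrow> infsum (\<lambda>s. of_bool (d s = 0) * w s) S"
  proof (rule tendsto_infsum_dominated[where h = w])
    show "norm (?a N s * w s) \<le> norm (w s)" for N s
      using mult_right_mono[OF a_norm[of N s] norm_ge_zero[of "w s"]] by (simp only: norm_mult mult_1)
    fix s assume "s \<in> S"
    show "(\<lambda>N. ?a N s * w s) \<longlonglongrightarrow> of_bool (d s = 0) * w s"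
    proof (cases "d s = 0")
      case True then show ?thesis by (simp del: of_nat_Suc)
    next
      case False
      have "\<forall>\<^sub>F N in sequentially. ?a N s * w s = of_bool (d s = 0) * w s"
        using eventually_gt_at_top[of "nat \<bar>d s\<bar>"]
        by eventually_elim (use False a_zero in auto)
      then show ?thesis by (rule tendsto_eventually)
    qed
  qed (use w in auto)
  moreover have "infsum (\<lambda>s. of_bool (d s = 0) * w s) S = infsum w {s \<in> S. d s = 0}"
    by (rule infsum_cong_neutral) auto
  moreover have "infsum (\<lambda>s. ?a N s * w s) S = (\<Sum>k<Suc N. f (?z N k)) / Suc N" for N
  proof (rule infsumI)
    have "((\<lambda>s. \<Sum>k<Suc N. w s * ?z N k powi d s) has_sum (\<Sum>k<Suc N. f (?z N k))) S"
      by (intro has_sum_sum_finite f) auto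
    from has_sum_cmult_left[OF this, of "1 / Suc N"]
    show "((\<lambda>s. ?a N s * w s) has_sum (\<Sum>k<Suc N. f (?z N k)) / Suc N) S"
      by (simp add: mult.commute flip: sum_distrib_left del: sum.lessThan_Suc of_nat_Suc)
  qed
  ultimately show ?thesis by (simp only:)
qed

section \<open>Infinite products and the finite q-binomial theorem\<close>

lemma convergent_prod_qpochhammer:
  assumes "norm q < 1"
  shows "convergent_prod (\<lambda>j. 1 - a * q ^ j :: complex)"
proof -
  have "summable (\<lambda>j. norm a * norm q ^ j)"
    using assms by (intro summable_mult summable_geometric) auto
  then have "abs_convergent_prod (\<lambda>j. 1 - a * q ^ j)"
    by (simp add: abs_convergent_prod_conv_summable norm_mult norm_power)
  then show ?thesis by (rule abs_convergent_prod_imp_convergent_prod)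
qed

lemma qpochhammer_LIMSEQ:
  assumes "norm q < 1"
  shows "(\<lambda>n. \<Prod>j<n. 1 - a * q ^ j) \<longlonglongrightarrow> qpochhammer_inf a q"
  using convergent_prod_LIMSEQ[OF convergent_prod_qpochhammer[OF assms, of a]]
  unfolding qpochhammer_inf_def LIMSEQ_lessThan_iff_atMost .

lemma qpochhammer_inf_nonzero:
  assumes "norm q < 1" "norm a < 1"
  shows "qpochhammer_inf a q \<noteq> 0"
  unfolding qpochhammer_inf_def
proof (rule prodinf_nonzero[OF convergent_prod_qpochhammer[OF assms(1)]])
  fix j
  have "norm (a * q ^ j) < 1"
    using assms mult_left_mono[of "norm q ^ j" 1 "norm a"]
    by (simp add: norm_mult norm_power power_le_one)
  then show "1 - a * q ^ j \<noteq> 0" by auto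
qed

lemma norm_power_less_1: "norm q < 1 \<Longrightarrow> n > 0 \<Longrightarrow> norm (q ^ n :: complex) < 1"
  by (simp add: norm_power power_less_one_iff)

lemma euler_prod_power_nonzero:
  assumes "norm q < 1" "n > 0"
  shows "euler_prod (q ^ n) \<noteq> 0"
  using assms by (intro qpochhammer_inf_nonzero norm_power_less_1)

lemma euler_prod_nonzero: "norm q < 1 \<Longrightarrow> euler_prod q \<noteq> 0"
  using euler_prod_power_nonzero[of q 1] by simp

text \<open>The factors are grouped by the residue of their exponent modulo \<open>k\<close>. The
  partial products are taken at \<open>n * k\<close> factors, where all residue classes have equal
  length.\<close>

lemma qpochhammer_inf_dissect:
  assumes "norm q < 1" "k > 0"
  shows "qpochhammer_inf a q = (\<Prod>i<k. qpochhammer_inf (a * q ^ i) (q ^ k))"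
proof -
  have "(\<Prod>j<n * k. 1 - a * q ^ j) = (\<Prod>i<k. \<Prod>j<n. 1 - a * q ^ i * (q ^ k) ^ j)" for n
  proof -
    have "(\<Prod>j<n * k. 1 - a * q ^ j) = (\<Prod>j<n. \<Prod>i\<in>{j*k..<j*k+k}. 1 - a * q ^ i)"
      by (simp add: prod.nat_group)
    also have "\<dots> = (\<Prod>j<n. \<Prod>i<k. 1 - a * q ^ (i + j * k))"
    proof (rule prod.cong[OF refl])
      fix j
      show "(\<Prod>i\<in>{j*k..<j*k+k}. 1 - a * q ^ i) = (\<Prod>i<k. 1 - a * q ^ (i + j * k))"
        using prod.shift_bounds_nat_ivl[of "\<lambda>i. 1 - a * q ^ i" 0 "j * k" k]
        by (simp add: add.commute lessThan_atLeast0)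
    qed
    also have "\<dots> = (\<Prod>i<k. \<Prod>j<n. 1 - a * q ^ (i + j * k))" by (rule prod.swap)
    finally have *: "(\<Prod>j<n * k. 1 - a * q ^ j) = (\<Prod>i<k. \<Prod>j<n. 1 - a * q ^ (i + j * k))" .
    have "q ^ (i + j * k) = q ^ i * (q ^ k) ^ j" for i j
      by (simp add: power_add mult.commute[of j k] power_mult)
    then show ?thesis unfolding * by (simp only: mult.assoc)
  qed
  moreover have "(\<lambda>n. \<Prod>i<k. \<Prod>j<n. 1 - a * q ^ i * (q ^ k) ^ j)
      \<longlonglongrightarrow> (\<Prod>i<k. qpochhammer_inf (a * q ^ i) (q ^ k))"
    using assms by (intro tendsto_prod qpochhammer_LIMSEQ norm_power_less_1) auto
  moreover have "(\<lambda>n. \<Prod>j<n * k. 1 - a * q ^ j) \<longlonglongrightarrow> qpochhammer_inf a q"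
    using qpochhammer_LIMSEQ[OF assms(1), of a] \<open>k > 0\<close>
    by (rule filterlim_compose[OF _ mult_nat_right_at_top])
  ultimately show ?thesis using LIMSEQ_unique by simp
qed

lemma qpochhammer_inf_mult_uminus:
  assumes "norm q < 1"
  shows "qpochhammer_inf a q * qpochhammer_inf (- a) q = qpochhammer_inf (a\<^sup>2) (q\<^sup>2)"
  unfolding qpochhammer_inf_def
  using prodinf_mult[OF convergent_prod_qpochhammer[OF assms, of a] convergent_prod_qpochhammer[OF assms, of "- a"]]
  by (simp add: algebra_simps power2_eq_square power_mult_distrib)

lemma qpochhammer_inf_mult_cube_roots:
  assumes "norm q < 1" "\<omega>\<^sup>2 + \<omega> + 1 = 0"
  shows "qpochhammer_inf a q * qpochhammer_inf (\<omega> * a) q * qpochhammer_inf (\<omega>\<^sup>2 * a) q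
    = qpochhammer_inf (a ^ 3) (q ^ 3)"
proof -
  note c = convergent_prod_qpochhammer[OF assms(1)]
  have *: "(1 - a * q ^ j) * (1 - \<omega> * a * q ^ j) * (1 - \<omega>\<^sup>2 * a * q ^ j) = 1 - a ^ 3 * (q ^ 3) ^ j" for j
  proof -
    have "(1 - x) * (1 - \<omega> * x) * (1 - \<omega>\<^sup>2 * x) = 1 - x ^ 3" for x
      using assms(2) by algebra
    from this[of "a * q ^ j"]
    have "(1 - a * q ^ j) * (1 - \<omega> * a * q ^ j) * (1 - \<omega>\<^sup>2 * a * q ^ j) = 1 - (a * q ^ j) ^ 3"
      by (simp only: mult.assoc)
    also have "(a * q ^ j) ^ 3 = a ^ 3 * (q ^ 3) ^ j"
      by (simp add: power_mult_distrib mult.commute flip: power_mult)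
    finally show ?thesis .
  qed
  have "qpochhammer_inf a q * qpochhammer_inf (\<omega> * a) q * qpochhammer_inf (\<omega>\<^sup>2 * a) q
      = (\<Prod>j. (1 - a * q ^ j) * (1 - \<omega> * a * q ^ j) * (1 - \<omega>\<^sup>2 * a * q ^ j))"
    unfolding qpochhammer_inf_def
    by (simp add: prodinf_mult[OF c c] prodinf_mult[OF convergent_prod_mult[OF c c] c])
  then show ?thesis unfolding * qpochhammer_inf_def .
qed

lemma qpochhammer_inf_head:
  assumes "norm q < 1"
  shows "qpochhammer_inf a q = (1 - a) * qpochhammer_inf (a * q) q"
proof -
  have "(\<lambda>n. \<Prod>j<Suc n. 1 - a * q ^ j) \<longlonglongrightarrow> qpochhammer_inf a q"
    using qpochhammer_LIMSEQ[OF assms] by (rule LIMSEQ_Suc)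
  moreover have "(\<lambda>n. (1 - a) * (\<Prod>j<n. 1 - a * q * q ^ j)) \<longlonglongrightarrow> (1 - a) * qpochhammer_inf (a * q) q"
    by (intro tendsto_intros qpochhammer_LIMSEQ assms)
  ultimately show ?thesis
    by (simp add: prod.lessThan_Suc_shift mult.assoc LIMSEQ_unique del: prod.lessThan_Suc)
qed

section \<open>The two-sided theta series and its convergence\<close>

definition tri :: "int \<Rightarrow> int" where "tri m = m * (m + 1) div 2"

text \<open>The division in \<open>tri\<close> is exact because one of two consecutive integers is
  even. Exponent identities below are checked in doubled form, which removes
  \<open>div\<close>.\<close>

lemma two_tri: "2 * tri m = m * (m + 1)"
  by (simp add: tri_def)

lemma tri_eqI: "m * (m + 1) = 2 * k \<Longrightarrow> tri m = k"
  using two_tri[of m] by linarith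

text \<open>Jacobi's theta function, normalised so that its exponents are triangular numbers. All
  one-dimensional theta series below are values of it at a power of \<open>q\<close>.\<close>

definition jtheta :: "complex \<Rightarrow> complex \<Rightarrow> complex" where
  "jtheta q z = (\<Sum>\<^sub>\<infinity>m. q powi tri m * z powi m)"

text \<open>The ratio of consecutive terms is \<open>q ^ Suc n * z\<close>, which tends to 0 for
  every \<open>z\<close>. The degenerate case is separate because the exponent law for
  \<open>powi\<close> is applied with \<open>q \<noteq> 0\<close>.\<close>

lemma summable_jtheta_nat:
  fixes q z :: complex
  assumes "norm q < 1"
  shows "summable (\<lambda>n. norm (q powi tri (int n) * z ^ n))"
proof (cases "q = 0 \<or> z = 0")
  case True
  have "norm (q powi tri (int n) * z ^ n) = 0" if "n \<ge> 1" for n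
  proof -
    have "int n * (int n + 1) \<noteq> 0" using that by simp
    then have "tri (int n) \<noteq> 0" using two_tri[of "int n"] by linarith
    then show ?thesis using True that by auto
  qed
  then have "\<forall>\<^sub>F n in sequentially. norm (norm (q powi tri (int n) * z ^ n)) \<le> 0"
    by (intro eventually_sequentiallyI[of 1]) simp
  then show ?thesis by (rule summable_comparison_test_ev[OF _ summable_zero])
next
  case False
  then have q0: "q \<noteq> 0" by simp
  have "(\<lambda>n. norm q ^ Suc n * norm z) \<longlonglongrightarrow> 0 * norm z"
    using assms by (intro tendsto_mult[OF LIMSEQ_Suc[OF LIMSEQ_power_zero] tendsto_const]) auto
  then have "\<forall>\<^sub>F n in sequentially. norm q ^ Suc n * norm z < 1 / 2"
    by (rule order_tendstoD) auto
  then obtain N where N: "\<And>n. n \<ge> N \<Longrightarrow> norm q ^ Suc n * norm z < 1 / 2"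
    by (auto simp: eventually_at_top_linorder)
  show ?thesis
  proof (rule summable_ratio_test[of "1 / 2" N])
    fix n assume "n \<ge> N"
    have "tri (int (Suc n)) = tri (int n) + int (Suc n)"
      using two_tri[of "int n"] by (intro tri_eqI) (simp add: algebra_simps)
    then have "q powi tri (int (Suc n)) = q powi tri (int n) * q ^ Suc n"
      using power_int_add[OF disjI1[OF q0], of "tri (int n)" "int (Suc n)"]
      by (simp only: power_int_of_nat)
    then have "q powi tri (int (Suc n)) * z ^ Suc n = (q ^ Suc n * z) * (q powi tri (int n) * z ^ n)"
      by (simp only: power_Suc mult_ac)
    then have "norm (q powi tri (int (Suc n)) * z ^ Suc n)
        = (norm q ^ Suc n * norm z) * norm (q powi tri (int n) * z ^ n)"
      by (simp only: norm_mult norm_power)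
    also have "\<dots> \<le> 1 / 2 * norm (q powi tri (int n) * z ^ n)"
      using N[OF \<open>n \<ge> N\<close>] by (intro mult_right_mono) auto
    finally show "norm (norm (q powi tri (int (Suc n)) * z ^ Suc n))
        \<le> 1 / 2 * norm (norm (q powi tri (int n) * z ^ n))" by simp
  qed auto
qed

text \<open>The reflection of \<open>m\<close> to \<open>- 1 - m\<close> fixes \<open>tri m\<close>.
  It turns the negative half of the series into \<open>inverse z\<close> times the nonnegative half
  at \<open>inverse z\<close>.\<close>

lemma jtheta_has_sum:
  fixes q z :: complex
  assumes "norm q < 1"
  shows "((\<lambda>m. q powi tri m * z powi m) has_sum jtheta q z) UNIV"
proof -
  let ?f = "\<lambda>m. q powi tri m * z powi m"
  have nn: "?f summable_on range int"
    using summable_jtheta_nat[OF assms, of z]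
    by (subst summable_on_reindex) (auto simp: o_def norm_summable_imp_summable_on)
  have "(\<lambda>n. inverse z * (q powi tri (int n) * inverse z ^ n)) summable_on UNIV"
    using summable_jtheta_nat[OF assms, of "inverse z"]
    by (intro summable_on_cmult_right norm_summable_imp_summable_on)
  moreover have "tri (- 1 - int n) = tri (int n)" for n
    using two_tri[of "int n"] by (intro tri_eqI) (simp add: algebra_simps)
  moreover have "z powi (- 1 - int n) = inverse z * inverse z ^ n" for n
    by (simp add: power_int_def nat_add_distrib)
  ultimately have "(?f \<circ> (\<lambda>n. - 1 - int n)) summable_on UNIV"
    by (simp add: o_def mult_ac)
  then have ng: "?f summable_on range (\<lambda>n. - 1 - int n)"
    by (subst summable_on_reindex) (auto simp: inj_def)
  have "range int \<union> range (\<lambda>n. - 1 - int n) = UNIV"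
  proof (intro equalityI subsetI)
    fix m :: int
    show "m \<in> range int \<union> range (\<lambda>n. - 1 - int n)"
      by (cases "m \<ge> 0") (auto intro: range_eqI[of _ _ "nat m"] range_eqI[of _ _ "nat (- 1 - m)"])
  qed auto
  then have "?f summable_on UNIV"
    using summable_on_union[OF nn ng] by simp
  then show ?thesis unfolding jtheta_def by simp
qed

section \<open>Gaussian binomial coefficients\<close>

definition qfact :: "complex \<Rightarrow> nat \<Rightarrow> complex" where
  "qfact q n = (\<Prod>i<n. 1 - q ^ Suc i)"

lemma qfact_0 [simp]: "qfact q 0 = 1" and qfact_Suc [simp]: "qfact q (Suc n) = qfact q n * (1 - q ^ Suc n)"
  by (simp_all add: qfact_def)

lemma qfact_nonzero:
  assumes "norm q < 1"
  shows "qfact q n \<noteq> 0"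
proof -
  have "q ^ Suc i \<noteq> 1" for i
    using norm_power_less_1[OF assms, of "Suc i"] by (metis norm_one less_irrefl zero_less_Suc)
  then show ?thesis by (auto simp: qfact_def simp del: power_Suc)
qed

lemma qfact_LIMSEQ: "norm q < 1 \<Longrightarrow> qfact q \<longlonglongrightarrow> euler_prod q"
  using qpochhammer_LIMSEQ[of q q] by (simp add: qfact_def[abs_def])

text \<open>For \<open>k > n\<close> the truncated subtraction gives a value that is not 0 in
  general, so all uses keep \<open>k \<le> n\<close>.\<close>

definition qbinomial :: "complex \<Rightarrow> nat \<Rightarrow> nat \<Rightarrow> complex" where
  "qbinomial q n k = qfact q n / (qfact q k * qfact q (n - k))"

text \<open>A q-analogue of Pascal's rule, from \<open>1 - q ^ Suc n = (1 - q ^ (n - k)) + q ^ (n -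
  k) * (1 - q ^ Suc k)\<close>.\<close>

lemma qbinomial_Suc:
  assumes "norm q < 1" "k < n"
  shows "qbinomial q (Suc n) (Suc k) = qbinomial q n (Suc k) + q ^ (n - k) * qbinomial q n k"
proof -
  define d where "d = n - Suc k"
  have n: "n = Suc (k + d)" using assms by (simp add: d_def)
  note nz = qfact_nonzero[OF assms(1)]
  have nz': "1 - q ^ Suc i \<noteq> 0" for i using nz[of "Suc i"] by (auto simp del: power_Suc)
  have "qbinomial q (Suc n) (Suc k) = qfact q n * (1 - q ^ Suc n) / (qfact q k * (1 - q ^ Suc k) * (qfact q d * (1 - q ^ Suc d)))"
    by (simp add: qbinomial_def n)
  also have "\<dots> = qfact q n * ((1 - q ^ Suc d) + q ^ Suc d * (1 - q ^ Suc k)) / (qfact q k * (1 - q ^ Suc k) * (qfact q d * (1 - q ^ Suc d)))"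
    by (simp add: n algebra_simps power_add)
  also have "\<dots> = qfact q n / (qfact q k * (1 - q ^ Suc k) * qfact q d)
      + q ^ Suc d * (qfact q n / (qfact q k * (qfact q d * (1 - q ^ Suc d))))"
    using nz nz' by (simp add: divide_simps del: power_Suc) (simp add: algebra_simps)
  also have "\<dots> = qbinomial q n (Suc k) + q ^ (n - k) * qbinomial q n k"
    by (simp add: qbinomial_def n)
  finally show ?thesis .
qed

lemma qbinomial_theorem:
  assumes "norm q < 1"
  shows "(\<Prod>i<n. 1 + x * q ^ i) = (\<Sum>k\<le>n. qbinomial q n k * q ^ (k * (k - 1) div 2) * x ^ k)"
proof (induction n)
  case 0 then show ?case by (simp add: qbinomial_def)
next
  case (Suc n)
  let ?t = "\<lambda>k. q ^ (k * (k - 1) div 2) * x ^ k"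
  note nz = qfact_nonzero[OF assms]
  \<comment> \<open>Multiplication by the new factor's \<open>x * q ^ n\<close> moves a term to the
    next index, because \<open>k * (k - 1) div 2 + k\<close> is the next triangular number.\<close>
  have t: "x * q ^ n * ?t k = q ^ (n - k) * ?t (Suc k)" if "k \<le> n" for k
  proof -
    have "Suc k * k div 2 = k * (k - 1) div 2 + k"
    proof -
      have "even (k * (k - 1))" by (cases k) auto
      then have "2 * (k * (k - 1) div 2) = k * (k - 1)" by simp
      moreover have "Suc k * k = k * (k - 1) + 2 * k" by (cases k) auto
      ultimately show ?thesis by presburger
    qed
    then have "q ^ (n - k) * ?t (Suc k) = q ^ (n - k) * q ^ k * q ^ (k * (k - 1) div 2) * x ^ Suc k"
      by (simp add: power_add mult_ac)
    also have "q ^ (n - k) * q ^ k = q ^ n" using that by (simp flip: power_add)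
    also have "q ^ n * q ^ (k * (k - 1) div 2) * x ^ Suc k = x * q ^ n * ?t k" by (simp only: power_Suc mult_ac)
    finally show ?thesis by (rule sym)
  qed
  have "(\<Prod>i<Suc n. 1 + x * q ^ i) = (\<Sum>k\<le>n. qbinomial q n k * ?t k) * (1 + x * q ^ n)"
    using Suc.IH by (simp add: mult.assoc)
  also have "\<dots> = (\<Sum>k\<le>n. qbinomial q n k * ?t k) + (\<Sum>k\<le>n. qbinomial q n k * (x * q ^ n * ?t k))"
    unfolding distrib_left mult_1_right sum_distrib_right by (simp only: mult_ac)
  also have "(\<Sum>k\<le>n. qbinomial q n k * (x * q ^ n * ?t k)) = (\<Sum>k\<le>n. qbinomial q n k * (q ^ (n - k) * ?t (Suc k)))"
    by (intro sum.cong refl) (simp only: t atMost_iff)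
  also have "\<dots> = (\<Sum>k<n. q ^ (n - k) * qbinomial q n k * ?t (Suc k)) + ?t (Suc n)"
    using nz by (simp add: qbinomial_def mult_ac lessThan_Suc_atMost[symmetric])
  also have "(\<Sum>k\<le>n. qbinomial q n k * ?t k) = 1 + (\<Sum>k<n. qbinomial q n (Suc k) * ?t (Suc k))"
    using nz by (simp add: qbinomial_def sum.atMost_shift)
  also have "1 + (\<Sum>k<n. qbinomial q n (Suc k) * ?t (Suc k))
        + ((\<Sum>k<n. q ^ (n - k) * qbinomial q n k * ?t (Suc k)) + ?t (Suc n))
      = 1 + (\<Sum>k<n. qbinomial q (Suc n) (Suc k) * ?t (Suc k)) + ?t (Suc n)"
    by (simp add: qbinomial_Suc[OF assms] sum.distrib distrib_right)
  also have "\<dots> = (\<Sum>k\<le>Suc n. qbinomial q (Suc n) k * ?t k)"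
    using nz by (simp add: qbinomial_def sum.atMost_shift del: sum.atMost_Suc qfact_Suc)
  finally show ?case by (simp add: mult.assoc)
qed

section \<open>The Jacobi triple product\<close>

lemma prod_lessThan_add:
  fixes f :: "nat \<Rightarrow> 'a :: comm_monoid_mult"
  shows "(\<Prod>i<n + m. f i) = (\<Prod>i<n. f i) * (\<Prod>i<m. f (n + i))"
  by (induction m) (simp_all add: mult.assoc)

text \<open>The q-binomial theorem with \<open>2 * n\<close> factors at
  \<open>x = z * q powi (1 - int n)\<close>. The upper half of the factors is the first product. In
  the lower half, read backwards, each factor yields \<open>z * q powi (- int i)\<close> times a
  factor of the second product, and \<open>c\<close> collects these monomials.\<close>

lemma finite_jacobi_triple_product:
  assumes q: "norm q < 1" "q \<noteq> 0" and z: "z \<noteq> 0"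
  shows "(\<Prod>i<n. 1 + z * q ^ Suc i) * (\<Prod>i<n. 1 + inverse z * q ^ i)
    = (\<Sum>k\<le>2 * n. qbinomial q (2 * n) k * (q powi tri (int k - int n) * z powi (int k - int n)))"
proof -
  define x where "x = z * q powi (1 - int n)"
  define c where "c = z ^ n * q powi (- tri (int n - 1))"
  have c0: "c \<noteq> 0" using q z by (simp add: c_def)
  have pw: "q ^ k = q powi int k" for k by simp
  have second: "1 + x * q ^ (n + i) = 1 + z * q ^ Suc i" for i
    unfolding x_def pw using q by (simp add: mult.assoc flip: power_int_add del: power_int_of_nat)
  have first: "1 + x * q ^ (n - Suc i) = (z * q powi (- int i)) * (1 + inverse z * q ^ i)" if "i < n" for i
  proof -
    have "x * q ^ (n - Suc i) = z * q powi (- int i)"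
      unfolding x_def pw using q that by (simp add: mult.assoc of_nat_diff flip: power_int_add del: power_int_of_nat)
    moreover have "q powi (- int i) * q ^ i = 1"
      using q by (simp add: power_int_minus)
    ultimately show ?thesis using z by (simp add: algebra_simps)
  qed
  have cprod: "(\<Prod>i<m. z * q powi (- int i)) = z ^ m * q powi (- tri (int m - 1))" for m
  proof (induction m)
    case 0 then show ?case by (simp add: tri_def)
  next
    case (Suc m)
    have "tri (int (Suc m) - 1) = tri (int m - 1) + int m"
      using two_tri[of "int m - 1"] by (intro tri_eqI) (simp add: algebra_simps)
    then show ?case using Suc q by (simp add: power_int_diff power_int_minus field_simps)
  qed
  have "(\<Prod>i<2 * n. 1 + x * q ^ i) = (\<Prod>i<n. 1 + x * q ^ i) * (\<Prod>i<n. 1 + z * q ^ Suc i)"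
    unfolding mult_2 prod_lessThan_add second ..
  also have "(\<Prod>i<n. 1 + x * q ^ i) = (\<Prod>i<n. 1 + x * q ^ (n - Suc i))"
    by (rule prod.nat_diff_reindex[symmetric])
  also have "\<dots> = c * (\<Prod>i<n. 1 + inverse z * q ^ i)"
    by (simp add: first prod.distrib c_def flip: cprod)
  finally have lhs: "c * ((\<Prod>i<n. 1 + z * q ^ Suc i) * (\<Prod>i<n. 1 + inverse z * q ^ i))
      = (\<Prod>i<2 * n. 1 + x * q ^ i)"
    by (simp only: mult_ac)
  have trm: "q ^ (k * (k - 1) div 2) * x ^ k = c * (q powi tri (int k - int n) * z powi (int k - int n))" for k
  proof -
    have "int (k * (k - 1) div 2) = tri (int k - 1)"
      by (cases k) (simp_all add: tri_def zdiv_int algebra_simps)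
    then have e1: "q ^ (k * (k - 1) div 2) = q powi tri (int k - 1)" unfolding pw by simp
    have "tri (int k - 1) + (1 - int n) * int k = - tri (int n - 1) + tri (int k - int n)"
      using two_tri[of "int k - 1"] two_tri[of "int n - 1"] two_tri[of "int k - int n"]
      by (simp add: algebra_simps)
    then have "q powi tri (int k - 1) * q powi ((1 - int n) * int k) = q powi (- tri (int n - 1)) * q powi tri (int k - int n)"
      using q by (simp flip: power_int_add)
    moreover have "x ^ k = z ^ k * q powi ((1 - int n) * int k)"
      by (simp add: x_def power_mult_distrib power_int_power')
    moreover have "z ^ k = z ^ n * z powi (int k - int n)"
      using z by (simp add: power_int_diff)
    ultimately show ?thesis unfolding e1 c_def by (simp add: mult_ac)
  qed
  have "c * ((\<Prod>i<n. 1 + z * q ^ Suc i) * (\<Prod>i<n. 1 + inverse z * q ^ i))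
      = c * (\<Sum>k\<le>2 * n. qbinomial q (2 * n) k * (q powi tri (int k - int n) * z powi (int k - int n)))"
    unfolding lhs qbinomial_theorem[OF q(1), where n = "2 * n"] mult.assoc trm sum_distrib_left
    by (simp only: mult_ac)
  then show ?thesis using c0 by simp
qed

text \<open>The limit of the finite identity: for fixed \<open>m\<close> the central Gaussian
  coefficients tend to \<open>1 / euler_prod q\<close>. Since \<open>qfact q n\<close> converges to
  a nonzero limit, it and its inverse are bounded, so a multiple of the theta series
  dominates.\<close>

lemma jacobi_triple_product:
  assumes q: "norm q < 1" "q \<noteq> 0" and z: "z \<noteq> 0"
  shows "jtheta q z = euler_prod q * qpochhammer_inf (- z * q) q * qpochhammer_inf (- inverse z) q"
proof -
  let ?t = "\<lambda>m. q powi tri m * z powi m"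
  \<comment> \<open>Extension by 0 turns the finite sums into sums over all integers, as dominated
    convergence needs a fixed index set.\<close>
  define c where "c n m = (if - int n \<le> m \<and> m \<le> int n then qbinomial q (2 * n) (nat (m + int n)) else 0)" for n m
  have t: "?t summable_on UNIV" using jtheta_has_sum[OF q(1)] by (rule has_sum_imp_summable)
  have E0: "euler_prod q \<noteq> 0" using euler_prod_nonzero[OF q(1)] .
  note qf = qfact_LIMSEQ[OF q(1)]
  obtain K where K: "\<And>n. norm (qfact q n) \<le> K"
    using convergent_imp_Bseq[OF convergentI[OF qf]] by (auto simp: Bseq_def)
  have "(\<lambda>n. inverse (qfact q n)) \<longlonglongrightarrow> inverse (euler_prod q)"
    using qf E0 by (rule tendsto_inverse)
  from convergent_imp_Bseq[OF convergentI[OF this]]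
  obtain K' where K': "\<And>n. norm (inverse (qfact q n)) \<le> K'" "K' > 0" by (auto simp: Bseq_def)
  have K0: "K \<ge> 0" using K[of 0] by simp
  have cb: "norm (c n m) \<le> K * (K' * K')" for n m
  proof (cases "- int n \<le> m \<and> m \<le> int n")
    case True
    have "norm (c n m) = norm (qfact q (2 * n)) * (norm (inverse (qfact q (nat (m + int n)))) * norm (inverse (qfact q (2 * n - nat (m + int n)))))"
      using True by (simp add: c_def qbinomial_def norm_mult norm_divide norm_inverse divide_inverse)
    also have "\<dots> \<le> K * (K' * K')" using K K' K0 by (intro mult_mono) auto
    finally show ?thesis .
  qed (use K0 K' in \<open>auto simp: c_def\<close>)
  have clim: "(\<lambda>n. c n m) \<longlonglongrightarrow> 1 / euler_prod q" for m
  proof -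
    have f1: "filterlim (\<lambda>n. nat (m + int n)) at_top sequentially"
      unfolding filterlim_at_top
    proof
      show "\<forall>\<^sub>F n in sequentially. Z \<le> nat (m + int n)" for Z
        by (rule eventually_sequentiallyI[of "Z + nat \<bar>m\<bar>"]) linarith
    qed
    have f2: "filterlim (\<lambda>n. 2 * n - nat (m + int n)) at_top sequentially"
      unfolding filterlim_at_top
    proof
      show "\<forall>\<^sub>F n in sequentially. Z \<le> 2 * n - nat (m + int n)" for Z
        by (rule eventually_sequentiallyI[of "Z + nat \<bar>m\<bar>"]) linarith
    qed
    have f3: "filterlim (\<lambda>n::nat. 2 * n) at_top sequentially"
      by (simp add: mult_nat_left_at_top)
    have "(\<lambda>n. qbinomial q (2 * n) (nat (m + int n))) \<longlonglongrightarrow> euler_prod q / (euler_prod q * euler_prod q)"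
      unfolding qbinomial_def using E0
      by (intro tendsto_intros filterlim_compose[OF qf] f1 f2 f3) auto
    then have "(\<lambda>n. qbinomial q (2 * n) (nat (m + int n))) \<longlonglongrightarrow> 1 / euler_prod q"
      using E0 by simp
    moreover have "\<forall>\<^sub>F n in sequentially. qbinomial q (2 * n) (nat (m + int n)) = c n m"
      by (intro eventually_sequentiallyI[of "nat \<bar>m\<bar>"]) (auto simp: c_def)
    ultimately show ?thesis by (rule Lim_transform_eventually)
  qed
  have "(\<lambda>n. infsum (\<lambda>m. c n m * ?t m) UNIV) \<longlonglongrightarrow> infsum (\<lambda>m. 1 / euler_prod q * ?t m) UNIV"
  proof (rule tendsto_infsum_dominated[where h = "\<lambda>m. of_real (K * (K' * K')) * ?t m"])
    show "(\<lambda>m. of_real (K * (K' * K')) * ?t m) summable_on UNIV"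
      using t by (rule summable_on_cmult_right)
    show "norm (c n m * ?t m) \<le> norm (of_real (K * (K' * K')) * ?t m)" for n m
    proof -
      have "norm (of_real (K * (K' * K')) :: complex) = K * (K' * K')"
        using K0 K' by (simp only: norm_of_real) (simp add: abs_mult)
      then show ?thesis
        unfolding norm_mult[of _ "?t m"] using cb[of n m] by (intro mult_right_mono) auto
    qed
    show "(\<lambda>n. c n m * ?t m) \<longlonglongrightarrow> 1 / euler_prod q * ?t m" for m
      by (intro tendsto_mult clim tendsto_const)
  qed
  moreover have "infsum (\<lambda>m. 1 / euler_prod q * ?t m) UNIV = 1 / euler_prod q * jtheta q z"
    unfolding jtheta_def by (rule infsum_cmult_right')
  moreover have "infsum (\<lambda>m. c n m * ?t m) UNIV = (\<Prod>i<n. 1 + z * q ^ Suc i) * (\<Prod>i<n. 1 + inverse z * q ^ i)" for n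
  proof -
    have "infsum (\<lambda>m. c n m * ?t m) UNIV = infsum (\<lambda>m. c n m * ?t m) {- int n..int n}"
      by (rule infsum_cong_neutral) (auto simp: c_def)
    also have "\<dots> = (\<Sum>m\<in>{- int n..int n}. c n m * ?t m)" by simp
    also have "\<dots> = (\<Sum>k\<le>2 * n. qbinomial q (2 * n) k * ?t (int k - int n))"
      by (rule sum.reindex_bij_witness[of _ "\<lambda>k. int k - int n" "\<lambda>m. nat (m + int n)"]) (auto simp: c_def)
    finally show ?thesis unfolding finite_jacobi_triple_product[OF q z] .
  qed
  moreover have "(\<lambda>n. (\<Prod>i<n. 1 + z * q ^ Suc i) * (\<Prod>i<n. 1 + inverse z * q ^ i))
      \<longlonglongrightarrow> qpochhammer_inf (- z * q) q * qpochhammer_inf (- inverse z) q"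
    using tendsto_mult[OF qpochhammer_LIMSEQ[OF q(1), of "- z * q"] qpochhammer_LIMSEQ[OF q(1), of "- inverse z"]]
    by (simp add: mult.assoc)
  ultimately have "1 / euler_prod q * jtheta q z = qpochhammer_inf (- z * q) q * qpochhammer_inf (- inverse z) q"
    using LIMSEQ_unique by simp
  then show ?thesis using E0 by (simp add: field_simps)
qed

section \<open>Frobenius symbols and the constant term of a theta product\<close>

text \<open>If the heads differed, each would lie in the tail of the other list, so \<open>R\<close>
  would hold between them in both directions.\<close>

lemma sorted_wrt_same_set_eq:
  assumes "sorted_wrt R xs" "sorted_wrt R ys" "set xs = set ys"
    and asym: "\<And>x y. R x y \<Longrightarrow> \<not> R y x"
  shows "xs = ys"
  using assms(1-3)
proof (induction xs arbitrary: ys)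
  case (Cons x xs)
  then obtain y ys' where ys: "ys = y # ys'" by (cases ys) auto
  have irr: "\<not> R a a" for a using asym by blast
  have "x = y"
  proof (rule ccontr)
    assume "x \<noteq> y"
    then have "x \<in> set ys'" "y \<in> set xs" using Cons.prems(3) ys by auto
    then show False using Cons.prems ys asym by auto
  qed
  moreover have "x \<notin> set xs" "y \<notin> set ys'" using Cons.prems(1,2) irr ys by auto
  ultimately have "set xs = set ys'" using Cons.prems(3) ys by (simp add: insert_ident)
  then have "xs = ys'" using Cons.prems(1,2) ys by (intro Cons.IH) auto
  then show ?case using ys \<open>x = y\<close> by simp
qed simp

lemma colored_less_irrefl: "\<not> colored_less x x"
  by (simp add: colored_less_def)

lemma frobenius_row_distinct: "frobenius_row k r \<Longrightarrow> distinct r"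
  unfolding frobenius_row_def by (induction r) (auto simp: colored_less_irrefl)

lemma frobenius_row_exists:
  assumes "X \<in> Fpow (UNIV \<times> {1..k})"
  shows "\<exists>r. frobenius_row k r \<and> set r = X"
proof -
  \<comment> \<open>Colours are at most \<open>k\<close>, so the colour is the remainder modulo
    \<open>Suc k\<close>. The coloured order thus becomes the usual order of the naturals, where
    sorting is available.\<close>
  define key :: "nat \<times> nat \<Rightarrow> nat" where "key = (\<lambda>(l, c). l * Suc k + c)"
  define dec where "dec n = (n div Suc k, n mod Suc k)" for n
  have X: "finite X" "\<And>x. x \<in> X \<Longrightarrow> snd x \<in> {1..k}" using assms by (auto simp: Fpow_def)
  have dk: "dec (key x) = x" if "x \<in> X" for x
    using X(2)[OF that] by (cases x) (simp add: dec_def key_def del: mult_Suc_right)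
  let ?L = "sorted_list_of_set (key ` X)"
  let ?r = "rev (map dec ?L)"
  have "set ?r = X" using X(1) dk by (simp add: image_image)
  moreover have mono: "colored_less (dec a) (dec b)" if "a < b" for a b
  proof -
    have "a div Suc k \<le> b div Suc k" using that by (intro div_le_mono) auto
    moreover have "a mod Suc k < b mod Suc k" if "a div Suc k = b div Suc k"
      using div_mult_mod_eq[of a "Suc k"] div_mult_mod_eq[of b "Suc k"] \<open>a < b\<close> that
      by (metis add_less_cancel_left)
    ultimately show ?thesis unfolding colored_less_def dec_def by (simp add: le_less) blast
  qed
  have "sorted_wrt (\<lambda>x y. colored_less y x) ?r"
    unfolding sorted_wrt_rev sorted_wrt_map
    by (rule sorted_wrt_mono_rel[OF _ strict_sorted_list_of_set]) (use mono in auto)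
  ultimately show ?thesis using X(2) by (intro exI[of _ ?r]) (auto simp: frobenius_row_def)
qed

lemma bij_betw_frobenius_row: "bij_betw set {r. frobenius_row k r} (Fpow (UNIV \<times> {1..k}))"
proof (rule bij_betw_imageI)
  show "inj_on set {r. frobenius_row k r}"
  proof (rule inj_onI)
    fix r r' assume "r \<in> {r. frobenius_row k r}" "r' \<in> {r. frobenius_row k r}" "set r = set r'"
    then show "r = r'"
      unfolding frobenius_row_def
      by (intro sorted_wrt_same_set_eq[of "\<lambda>x y. colored_less y x" r r']) (auto simp: colored_less_def)
  qed
  show "set ` {r. frobenius_row k r} = Fpow (UNIV \<times> {1..k})"
  proof (intro equalityI subsetI)
    fix X assume "X \<in> set ` {r. frobenius_row k r}"
    then show "X \<in> Fpow (UNIV \<times> {1..k})" by (auto simp: Fpow_def frobenius_row_def)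
  qed (use frobenius_row_exists in blast)
qed

text \<open>Each factor \<open>1 + y * q ^ l\<close> occurs once per colour, whence the
  \<open>k\<close>-th power.\<close>

lemma has_sum_row_products:
  assumes q: "norm q < 1"
  shows "((\<lambda>X. \<Prod>i\<in>X. y * q ^ fst i) has_sum qpochhammer_inf (- y) q ^ k) (Fpow (UNIV \<times> {1..k}))"
proof (rule has_sum_Fpow_prod[where A = "\<lambda>n. {..<n} \<times> {1..k}"])
  have "summable (\<lambda>l. norm (y * q ^ l))"
    using q by (simp add: norm_mult norm_power summable_mult summable_geometric)
  then have 1: "(\<lambda>l. y * q ^ l) summable_on UNIV" by (rule norm_summable_imp_summable_on)
  have 2: "((\<lambda>c. 1 :: complex) has_sum of_nat k) {1..k}" by (rule has_sum_finiteI) auto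
  from has_sum_times_complex[OF has_sum_infsum[OF 1] 2]
  show "(\<lambda>i. y * q ^ fst i) summable_on UNIV \<times> {1..k}"
    by (auto dest!: has_sum_imp_summable simp: case_prod_unfold)
  have "(\<lambda>n. (\<Prod>j<n. 1 - (- y) * q ^ j) ^ k) \<longlonglongrightarrow> qpochhammer_inf (- y) q ^ k"
    by (intro tendsto_power qpochhammer_LIMSEQ q)
  moreover have "(\<Prod>i\<in>{..<n} \<times> {1..k}. 1 + y * q ^ fst i) = (\<Prod>j<n. 1 - (- y) * q ^ j) ^ k" for n
    using prod.cartesian_product[of "\<lambda>j c. 1 + y * q ^ j" "{1..k}" "{..<n}"]
    by (simp add: case_prod_unfold prod_power_distrib)
  ultimately show "(\<lambda>n. \<Prod>i\<in>{..<n} \<times> {1..k}. 1 + y * q ^ fst i) \<longlonglongrightarrow> qpochhammer_inf (- y) q ^ k"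
    by simp
qed (auto simp: incseq_def)

text \<open>\<open>card X\<close> stands for the number of columns. Counting one row suffices, since
  only pairs of sets of equal size represent symbols.\<close>

definition pair_weight :: "complex \<Rightarrow> (nat \<times> nat) set \<times> (nat \<times> nat) set \<Rightarrow> complex" where
  "pair_weight q = (\<lambda>(X, Y). q ^ (card X + sum fst X + sum fst Y))"

definition pair_degree :: "'a set \<times> 'a set \<Rightarrow> int" where
  "pair_degree = (\<lambda>(X, Y). int (card X) - int (card Y))"

text \<open>The upper row is expanded at \<open>y = z * q\<close>, whose extra \<open>q\<close>
  counts the columns, and the lower row at \<open>y = inverse z\<close>. The power of
  \<open>z\<close> is then the difference of the row lengths.\<close>

lemma has_sum_pair_weight:
  assumes q: "norm q < 1" and z: "z \<noteq> 0"
  shows "((\<lambda>s. pair_weight q s * z powi pair_degree s) has_sum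
      (qpochhammer_inf (- z * q) q * qpochhammer_inf (- inverse z) q) ^ k)
      (Fpow (UNIV \<times> {1..k}) \<times> Fpow (UNIV \<times> {1..k}))"
proof -
  have "((\<lambda>(X, Y). (\<Prod>i\<in>X. z * q * q ^ fst i) * (\<Prod>i\<in>Y. inverse z * q ^ fst i)) has_sum
      qpochhammer_inf (- (z * q)) q ^ k * qpochhammer_inf (- inverse z) q ^ k)
      (Fpow (UNIV \<times> {1..k}) \<times> Fpow (UNIV \<times> {1..k}))"
    by (rule has_sum_times_complex[OF has_sum_row_products[OF q] has_sum_row_products[OF q]])
  moreover have "(\<Prod>i\<in>X. z * q * q ^ fst i) * (\<Prod>i\<in>Y. inverse z * q ^ fst i)
      = pair_weight q (X, Y) * z powi pair_degree (X, Y)" for X Y :: "(nat \<times> nat) set"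
    using z by (simp add: pair_weight_def pair_degree_def prod.distrib power_add power_mult_distrib
        power_sum power_int_diff divide_inverse power_inverse mult_ac)
  ultimately show ?thesis by (simp add: case_prod_unfold power_mult_distrib)
qed

text \<open>Rows correspond to finite sets. As their entries are distinct, length is cardinality,
  and equality of the row lengths becomes degree 0.\<close>

lemma has_sum_frobenius_symbols:
  assumes q: "norm q < 1"
  shows "((\<lambda>s. q ^ frobenius_weight s) has_sum
      infsum (pair_weight q) {s \<in> Fpow (UNIV \<times> {1..k}) \<times> Fpow (UNIV \<times> {1..k}). pair_degree s = 0})
      {s. frobenius_symbol k s}"
proof -
  let ?F = "Fpow (UNIV \<times> {1..k})"
  let ?S = "{s \<in> ?F \<times> ?F. pair_degree s = 0}"
  have "(pair_weight q) summable_on ?F \<times> ?F"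
    using has_sum_pair_weight[OF q, of 1 k] by (auto dest: has_sum_imp_summable)
  then have hs: "(pair_weight q has_sum infsum (pair_weight q) ?S) ?S"
    by (intro has_sum_infsum, elim summable_on_subset_banach) auto
  have bij: "bij_betw (map_prod set set) {s. frobenius_symbol k s} ?S"
  proof -
    let ?R = "{r. frobenius_row k r}"
    have b: "bij_betw (map_prod set set) (?R \<times> ?R) (?F \<times> ?F)"
      by (intro bij_betw_map_prod bij_betw_frobenius_row)
    have "map_prod set set ` {s \<in> ?R \<times> ?R. pair_degree (map_prod set set s) = 0} = ?S"
      unfolding bij_betw_imp_surj_on[OF b, symmetric] by (rule Compr_image_eq[symmetric])
    moreover have "inj_on (map_prod set set) {s \<in> ?R \<times> ?R. pair_degree (map_prod set set s) = 0}"
      using bij_betw_imp_inj_on[OF b] by (rule inj_on_subset) blast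
    moreover have "frobenius_symbol k s \<longleftrightarrow> s \<in> ?R \<times> ?R \<and> pair_degree (map_prod set set s) = 0" for s
    proof (cases s)
      case (Pair r r')
      then show ?thesis
        using distinct_card[OF frobenius_row_distinct, of k r] distinct_card[OF frobenius_row_distinct, of k r']
        by (auto simp: frobenius_symbol_def pair_degree_def)
    qed
    ultimately show ?thesis by (simp add: bij_betw_def)
  qed
  have eq: "pair_weight q (map_prod set set s) = q ^ frobenius_weight s" if "frobenius_symbol k s" for s
  proof (cases s)
    case (Pair r r')
    then have "distinct r" "distinct r'"
      using that frobenius_row_distinct by (auto simp: frobenius_symbol_def)
    then show ?thesis
      by (simp add: Pair pair_weight_def frobenius_weight_def distinct_card sum_list_distinct_conv_sum_set)
  qed
  have "((\<lambda>s. pair_weight q (map_prod set set s)) has_sum infsum (pair_weight q) ?S) {s. frobenius_symbol k s}"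
    using hs unfolding has_sum_reindex_bij_betw[OF bij] .
  then show ?thesis
    by (rule has_sum_cong[THEN iffD1, rotated]) (simp add: eq)
qed

text \<open>The symbols are sorted by weight; the fibre over \<open>n\<close> is the finite set that
  \<open>cphi k n\<close> counts.\<close>

lemma CPhi_sums:
  assumes q: "norm q < 1"
  shows "(\<lambda>n. of_nat (cphi k n) * q ^ n) sums
      infsum (pair_weight q) {s \<in> Fpow (UNIV \<times> {1..k}) \<times> Fpow (UNIV \<times> {1..k}). pair_degree s = 0}"
proof (rule has_sum_imp_sums, rule has_sum_SigmaD)
  show "((\<lambda>p. q ^ fst p) has_sum infsum (pair_weight q) {s \<in> Fpow (UNIV \<times> {1..k}) \<times> Fpow (UNIV \<times> {1..k}). pair_degree s = 0})
      (Sigma UNIV (frobenius_partitions k))"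
    by (rule has_sum_reindex_bij_witness[of _ "\<lambda>s. (frobenius_weight s, s)" snd
          "{s. frobenius_symbol k s}" "\<lambda>s. q ^ frobenius_weight s", THEN iffD2,
          OF _ _ _ _ _ refl has_sum_frobenius_symbols[OF q]])
       (auto simp: frobenius_partitions_def)
  show "((\<lambda>s. q ^ fst (n, s)) has_sum of_nat (cphi k n) * q ^ n) (frobenius_partitions k n)" for n
    by (rule has_sum_finiteI) (auto simp: finite_frobenius_partitions cphi_def)
qed

text \<open>The pairs of rows and the given family expand the same function on the unit circle.
  Averages over roots of unity therefore have one limit, and the two constant terms agree. The index
  set is arbitrary, so any convenient expansion of the theta power can be supplied.\<close>

lemma CPhi_eq_constant_term:
  fixes w :: "'a \<Rightarrow> complex" and d :: "'a \<Rightarrow> int"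
  assumes q: "norm q < 1" "q \<noteq> 0"
    and w: "\<And>z. norm z = 1 \<Longrightarrow> ((\<lambda>s. w s * z powi d s) has_sum jtheta q z ^ k) S"
  shows "euler_prod q ^ k * CPhi k q = infsum w {s \<in> S. d s = 0}"
proof -
  let ?F = "Fpow (UNIV \<times> {1..k})"
  let ?P = "\<lambda>z. (qpochhammer_inf (- z * q) q * qpochhammer_inf (- inverse z) q) ^ k"
  have "((\<lambda>s. euler_prod q ^ k * pair_weight q s * z powi pair_degree s) has_sum jtheta q z ^ k) (?F \<times> ?F)"
    if "norm z = 1" for z
  proof -
    have "z \<noteq> 0" using that by auto
    from has_sum_cmult_right[OF has_sum_pair_weight[OF q(1) this], of "euler_prod q ^ k" k]
    show ?thesis
      by (simp add: jacobi_triple_product[OF q \<open>z \<noteq> 0\<close>] power_mult_distrib mult.assoc)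
  qed
  from LIMSEQ_unique[OF root_unity_average_tendsto[OF this] root_unity_average_tendsto[OF w]]
  have "infsum (\<lambda>s. euler_prod q ^ k * pair_weight q s) {s \<in> ?F \<times> ?F. pair_degree s = 0}
      = infsum w {s \<in> S. d s = 0}" by simp
  moreover have "CPhi k q = infsum (pair_weight q) {s \<in> ?F \<times> ?F. pair_degree s = 0}"
    using CPhi_sums[OF q(1)] unfolding CPhi_def by (rule sums_unique[symmetric])
  ultimately show ?thesis by (simp add: infsum_cmult_right')
qed

section \<open>The sixth power of the theta series\<close>

lemma power_int_add_nonzero:
  fixes q :: complex
  shows "q \<noteq> 0 \<Longrightarrow> q powi (m + n) = q powi m * q powi n"
  by (simp add: power_int_add)

text \<open>The coefficient of \<open>z powi j\<close> in the cube of the theta series, with the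
  first index eliminated as \<open>j - b - c\<close>. The values at 0 and - 1 are the series a(q)
  and L(q).\<close>

definition jtheta_cube_coeff :: "complex \<Rightarrow> int \<Rightarrow> complex" where
  "jtheta_cube_coeff q j = (\<Sum>\<^sub>\<infinity>(b, c). q powi (tri b + tri c + tri (j - b - c)))"

lemma has_sum_jtheta_cube:
  assumes q: "norm q < 1" "q \<noteq> 0" and z: "z \<noteq> 0"
  shows "((\<lambda>(j, b, c). q powi (tri b + tri c + tri (j - b - c)) * z powi j) has_sum jtheta q z ^ 3) UNIV"
proof -
  note J = jtheta_has_sum[OF q(1), of z]
  have "((\<lambda>(a, b, c). (q powi tri a * z powi a) * ((q powi tri b * z powi b) * (q powi tri c * z powi c)))
      has_sum jtheta q z * (jtheta q z * jtheta q z)) (UNIV \<times> UNIV \<times> UNIV)"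
    using has_sum_times_complex[OF J has_sum_times_complex[OF J J]] by (simp add: case_prod_unfold)
  moreover have "jtheta q z * (jtheta q z * jtheta q z) = jtheta q z ^ 3"
    by (simp add: power3_eq_cube mult.assoc)
  ultimately have "((\<lambda>(a, b, c). (q powi tri a * z powi a) * ((q powi tri b * z powi b) * (q powi tri c * z powi c)))
      has_sum jtheta q z ^ 3) UNIV"
    by simp
  then show ?thesis
    by (rule has_sum_reindex_bij_witness[of _ "\<lambda>(j, b, c). (j - b - c, b, c)" "\<lambda>(a, b, c). (a + b + c, b, c)",
          THEN iffD1, OF _ _ _ _ _ refl, rotated -1])
       (use q z in \<open>auto simp: power_int_add algebra_simps\<close>)
qed

lemma has_sum_jtheta_cube_coeff:
  assumes q: "norm q < 1" "q \<noteq> 0"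
  shows "((\<lambda>(b, c). q powi (tri b + tri c + tri (j - b - c))) has_sum jtheta_cube_coeff q j) UNIV"
proof -
  have "(\<lambda>(j, b, c). q powi (tri b + tri c + tri (j - b - c))) summable_on UNIV \<times> UNIV"
    using has_sum_imp_summable[OF has_sum_jtheta_cube[OF q, of 1]] by simp
  then have "(\<lambda>(j, p). (\<lambda>(b, c). q powi (tri b + tri c + tri (j - b - c))) p) summable_on UNIV \<times> UNIV"
    by (simp add: case_prod_unfold)
  from summable_on_SigmaD1[OF this, of j] show ?thesis
    unfolding jtheta_cube_coeff_def by simp
qed

lemma has_sum_jtheta_cube_laurent:
  assumes q: "norm q < 1" "q \<noteq> 0" and z: "z \<noteq> 0"
  shows "((\<lambda>j. jtheta_cube_coeff q j * z powi j) has_sum jtheta q z ^ 3) UNIV"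
proof (rule has_sum_SigmaD)
  show "((\<lambda>(j, b, c). q powi (tri b + tri c + tri (j - b - c)) * z powi j) has_sum jtheta q z ^ 3) (UNIV \<times> UNIV)"
    using has_sum_jtheta_cube[OF assms] by simp
  show "((\<lambda>p. case (j, p) of (j, b, c) \<Rightarrow> q powi (tri b + tri c + tri (j - b - c)) * z powi j)
      has_sum jtheta_cube_coeff q j * z powi j) UNIV" for j
    using has_sum_cmult_left[OF has_sum_jtheta_cube_coeff[OF q], of j "z powi j"]
    by (simp add: case_prod_unfold)
qed

text \<open>Raising all three summation indices by 1 adds \<open>j + 3\<close> to the
  exponent.\<close>

lemma jtheta_cube_coeff_add_3:
  assumes q: "norm q < 1" "q \<noteq> 0"
  shows "jtheta_cube_coeff q (j + 3) = q powi (j + 3) * jtheta_cube_coeff q j"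
proof -
  have "tri (b + 1) + tri (c + 1) + tri (j + 3 - (b + 1) - (c + 1))
      = (j + 3) + (tri b + tri c + tri (j - b - c))" for b c
    using two_tri[of b] two_tri[of c] two_tri[of "j + 3 - (b + 1) - (c + 1)"] two_tri[of "b + 1"] two_tri[of "c + 1"]
      two_tri[of "j - b - c"]
    by (simp add: algebra_simps)
  then have e: "q powi (tri (b + 1) + tri (c + 1) + tri (j + 3 - (b + 1) - (c + 1)))
      = q powi (j + 3) * q powi (tri b + tri c + tri (j - b - c))" for b c
    using q by (simp only: power_int_add_nonzero not_False_eq_True)
  have bij: "bij_betw (\<lambda>p. (fst p + 1, snd p + 1)) UNIV (UNIV :: (int \<times> int) set)"
    by (rule bij_betwI[where g = "\<lambda>p. (fst p - 1, snd p - 1)"]) auto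
  have "((\<lambda>(b, c). q powi (j + 3) * q powi (tri b + tri c + tri (j - b - c)))
      has_sum q powi (j + 3) * jtheta_cube_coeff q j) UNIV"
    using has_sum_cmult_right[OF has_sum_jtheta_cube_coeff[OF q], of "q powi (j + 3)" j]
    by (simp add: case_prod_unfold)
  then have "((\<lambda>p. (\<lambda>(b, c). q powi (tri b + tri c + tri (j + 3 - b - c))) (fst p + 1, snd p + 1))
      has_sum q powi (j + 3) * jtheta_cube_coeff q j) UNIV"
    by (simp only: case_prod_unfold fst_conv snd_conv e)
  then show ?thesis
    unfolding has_sum_reindex_bij_betw[OF bij]
    using has_sum_jtheta_cube_coeff[OF q] has_sum_unique by blast
qed

lemma jtheta_cube_coeff_mod_3:
  assumes q: "norm q < 1" "q \<noteq> 0"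
  shows "jtheta_cube_coeff q (3 * s - r) = q powi (3 * tri s - r * s) * jtheta_cube_coeff q (- r)"
proof -
  have step: "3 * tri (i + 1) - r * (i + 1) = (3 * i + 3 - r) + (3 * tri i - r * i)" for i
    using two_tri[of i] two_tri[of "i + 1"] by (simp add: algebra_simps)
  have rec: "jtheta_cube_coeff q (3 * (i + 1) - r) = q powi (3 * i + 3 - r) * jtheta_cube_coeff q (3 * i - r)" for i
    using jtheta_cube_coeff_add_3[OF q, of "3 * i - r"] by (simp add: algebra_simps)
  show ?thesis
  proof (induction s rule: int_induct[where k = 0])
    case base then show ?case by (simp add: tri_def)
  next
    case (step1 i)
    then show ?case unfolding rec step using q by (simp add: power_int_add mult.assoc)
  next
    \<comment> \<open>Downwards the same recurrence is used, cancelling a power of \<open>q\<close>,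
      which is nonzero.\<close>
    case (step2 i)
    have "q powi (3 * (i - 1) + 3 - r) * jtheta_cube_coeff q (3 * (i - 1) - r)
        = q powi (3 * (i - 1) + 3 - r) * (q powi (3 * tri (i - 1) - r * (i - 1)) * jtheta_cube_coeff q (- r))"
      using rec[of "i - 1"] step[of "i - 1"] step2 q
      by (simp add: mult.assoc[symmetric] power_int_add[symmetric])
    then show ?case using q by simp
  qed
qed

text \<open>Reflecting each of the three indices by \<open>m\<close> to \<open>- 1 - m\<close> keeps
  the exponent and sends the index sum \<open>j\<close> to \<open>- 3 - j\<close>.\<close>

lemma jtheta_cube_coeff_minus_2:
  assumes q: "norm q < 1" "q \<noteq> 0"
  shows "jtheta_cube_coeff q (- 2) = jtheta_cube_coeff q (- 1)"
proof -
  have e: "tri (- 1 - b) + tri (- 1 - c) + tri (- 2 - (- 1 - b) - (- 1 - c)) = tri b + tri c + tri (- 1 - b - c)" for b c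
    using two_tri[of b] two_tri[of c] two_tri[of "- 2 - (- 1 - b) - (- 1 - c)"] two_tri[of "- 1 - b"]
      two_tri[of "- 1 - c"] two_tri[of "- 1 - b - c"]
    by (simp add: algebra_simps)
  have bij: "bij_betw (\<lambda>p. (- 1 - fst p, - 1 - snd p)) UNIV (UNIV :: (int \<times> int) set)"
    by (rule bij_betwI[where g = "\<lambda>p. (- 1 - fst p, - 1 - snd p)"]) auto
  have "((\<lambda>p. (\<lambda>(b, c). q powi (tri b + tri c + tri (- 2 - b - c))) (- 1 - fst p, - 1 - snd p))
      has_sum jtheta_cube_coeff q (- 1)) UNIV"
    using has_sum_jtheta_cube_coeff[OF q, of "- 1"] by (simp only: case_prod_unfold fst_conv snd_conv e)
  then show ?thesis
    unfolding has_sum_reindex_bij_betw[OF bij]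
    using has_sum_jtheta_cube_coeff[OF q] has_sum_unique by blast
qed

lemma has_sum_powi_tri_linear:
  assumes q: "norm q < 1" "q \<noteq> 0" and "a > 0"
    and e: "\<And>m. e m = int a * tri m + b * m"
  shows "((\<lambda>m. q powi e m) has_sum jtheta (q ^ a) (q powi b)) UNIV"
proof -
  have "q powi e m = (q ^ a) powi tri m * (q powi b) powi m" for m
    using q by (simp add: e power_int_add power_int_power flip: power_int_mult)
  then show ?thesis
    using jtheta_has_sum[OF norm_power_less_1[OF q(1) \<open>a > 0\<close>], of "q powi b"] by simp
qed

text \<open>Ramanujan's theta function, the sum of \<open>q powi m\<^sup>2\<close>: the linear
  factor cancels the linear part of \<open>2 * tri m\<close>.\<close>

definition phi :: "complex \<Rightarrow> complex" where
  "phi q = jtheta (q\<^sup>2) (q powi (- 1))"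

lemma has_sum_phi:
  assumes "norm q < 1" "q \<noteq> 0"
  shows "((\<lambda>m. q powi m\<^sup>2) has_sum phi q) UNIV"
  unfolding phi_def using two_tri
  by (intro has_sum_powi_tri_linear[OF assms]) (auto simp: power2_eq_square algebra_simps)

text \<open>The constant term of the squared cube is the sum of \<open>?h j * ?h (- j)\<close>.
  Split by \<open>j\<close> modulo 3, every coefficient reduces to \<open>?h 0\<close> or
  \<open>?h (- 1)\<close>, and the two nonzero classes contribute equally.\<close>

lemma CPhi_6_theta:
  assumes q: "norm q < 1" "q \<noteq> 0"
  shows "euler_prod q ^ 6 * CPhi 6 q = phi (q ^ 3) * (jtheta_cube_coeff q 0)\<^sup>2
    + 2 * q * (jtheta_cube_coeff q (- 1))\<^sup>2 * jtheta (q ^ 6) (q powi (- 1))"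
proof -
  let ?h = "jtheta_cube_coeff q"
  have "((\<lambda>(i, j). ?h i * ?h j * z powi (i + j)) has_sum jtheta q z ^ 6) UNIV" if "norm z = 1" for z
  proof -
    have "z \<noteq> 0" using that by auto
    note J = has_sum_jtheta_cube_laurent[OF q this]
    from has_sum_times_complex[OF J J] show ?thesis
      using \<open>z \<noteq> 0\<close> by (simp add: case_prod_unfold power_int_add mult_ac flip: power_add)
  qed
  then have hs: "((\<lambda>p. (?h (fst p) * ?h (snd p)) * z powi (fst p + snd p)) has_sum jtheta q z ^ 6) UNIV"
    if "norm z = 1" for z
    using that by (simp add: case_prod_unfold)
  have "(\<lambda>p. ?h (fst p) * ?h (snd p)) summable_on UNIV"
    using has_sum_imp_summable[OF hs[of 1]] by simp
  then have "(\<lambda>p. ?h (fst p) * ?h (snd p)) summable_on {p \<in> UNIV. fst p + snd p = 0}"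
    by (rule summable_on_subset_banach) auto
  moreover have "euler_prod q ^ 6 * CPhi 6 q = infsum (\<lambda>p. ?h (fst p) * ?h (snd p)) {p \<in> UNIV. fst p + snd p = 0}"
    by (rule CPhi_eq_constant_term[OF q]) (rule hs)
  ultimately have "((\<lambda>p. ?h (fst p) * ?h (snd p)) has_sum euler_prod q ^ 6 * CPhi 6 q) {p \<in> UNIV. fst p + snd p = 0}"
    by (simp only: has_sum_infsum)
  then have tot: "((\<lambda>j. ?h j * ?h (- j)) has_sum euler_prod q ^ 6 * CPhi 6 q) UNIV"
    by (rule has_sum_reindex_bij_witness[of _ "\<lambda>j. (j, - j)" fst, THEN iffD1, OF _ _ _ _ _ refl, rotated -1])
       (auto simp: add_eq_0_iff)
  let ?f = "jtheta (q ^ 6) (q powi (- 1))"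
  have "3 * m\<^sup>2 + 2 * m = int 6 * tri m + (- 1) * m" for m
    using two_tri[of m] by (simp add: power2_eq_square algebra_simps)
  then have f: "((\<lambda>m. q powi (3 * m\<^sup>2 + 2 * m)) has_sum ?f) UNIV"
    by (intro has_sum_powi_tri_linear[OF q]) simp_all
  have norm_cube_less_1: "norm (q ^ 3) < 1" using norm_power_less_1[OF q(1), of 3] by simp
  have c0: "((\<lambda>j. ?h j * ?h (- j)) has_sum phi (q ^ 3) * (?h 0)\<^sup>2) (range (\<lambda>s. 3 * s))"
  proof (subst has_sum_reindex)
    have "?h (3 * s) * ?h (- (3 * s)) = (q ^ 3) powi s\<^sup>2 * (?h 0)\<^sup>2" for s
    proof -
      have "3 * tri s + 3 * tri (- s) = 3 * s\<^sup>2"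
        using two_tri[of s] two_tri[of "- s"] by (simp add: power2_eq_square algebra_simps)
      then have "q powi (3 * tri s) * q powi (3 * tri (- s)) = (q ^ 3) powi s\<^sup>2"
        using q by (simp add: power_int_power flip: power_int_add)
      then show ?thesis
        using jtheta_cube_coeff_mod_3[OF q, of s 0] jtheta_cube_coeff_mod_3[OF q, of "- s" 0]
        by (simp add: power2_eq_square mult_ac)
    qed
    then show "((\<lambda>j. ?h j * ?h (- j)) \<circ> (\<lambda>s. 3 * s) has_sum phi (q ^ 3) * (?h 0)\<^sup>2) UNIV"
      using has_sum_cmult_left[OF has_sum_phi[OF norm_cube_less_1], of "(?h 0)\<^sup>2"] q by (simp add: o_def)
  qed (auto simp: inj_def)
  \<comment> \<open>The parameters \<open>- s\<close> here and \<open>s + 1\<close> in the next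
    class are chosen so that both give the exponent
    \<open>1 + (3 * s\<^sup>2 + 2 * s)\<close>.\<close>
  have c1: "((\<lambda>j. ?h j * ?h (- j)) has_sum q * (?h (- 1))\<^sup>2 * ?f) (range (\<lambda>s. 3 * (- s) - 1))"
  proof (subst has_sum_reindex)
    have "?h (3 * (- s) - 1) * ?h (- (3 * (- s) - 1)) = q * (?h (- 1))\<^sup>2 * q powi (3 * s\<^sup>2 + 2 * s)" for s
    proof -
      have neg: "- (3 * (- s) - 1) = 3 * (1 + s) - 2" by simp
      have "(3 * tri (- s) - 1 * (- s)) + (3 * tri (1 + s) - 2 * (1 + s)) = 1 + (3 * s\<^sup>2 + 2 * s)"
        using two_tri[of "- s"] two_tri[of "1 + s"] by (simp add: power2_eq_square algebra_simps)
      then have "q powi (3 * tri (- s) - 1 * (- s)) * q powi (3 * tri (1 + s) - 2 * (1 + s)) = q powi (1 + (3 * s\<^sup>2 + 2 * s))"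
        by (simp only: power_int_add_nonzero[OF q(2), symmetric])
      also have "\<dots> = q * q powi (3 * s\<^sup>2 + 2 * s)" using q by (subst power_int_add) auto
      finally show ?thesis
        unfolding neg jtheta_cube_coeff_mod_3[OF q] jtheta_cube_coeff_minus_2[OF q] by algebra
    qed
    then show "((\<lambda>j. ?h j * ?h (- j)) \<circ> (\<lambda>s. 3 * (- s) - 1) has_sum q * (?h (- 1))\<^sup>2 * ?f) UNIV"
      using has_sum_cmult_right[OF f, of "q * (?h (- 1))\<^sup>2"] by (simp add: o_def)
  qed (auto simp: inj_def)
  have c2: "((\<lambda>j. ?h j * ?h (- j)) has_sum q * (?h (- 1))\<^sup>2 * ?f) (range (\<lambda>s. 3 * (s + 1) - 2))"
  proof (subst has_sum_reindex)
    have "?h (3 * (s + 1) - 2) * ?h (- (3 * (s + 1) - 2)) = q * (?h (- 1))\<^sup>2 * q powi (3 * s\<^sup>2 + 2 * s)" for s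
    proof -
      have neg: "- (3 * (s + 1) - 2) = 3 * (- s) - 1" by simp
      have "(3 * tri (s + 1) - 2 * (s + 1)) + (3 * tri (- s) - 1 * (- s)) = 1 + (3 * s\<^sup>2 + 2 * s)"
        using two_tri[of "- s"] two_tri[of "s + 1"] by (simp add: power2_eq_square algebra_simps)
      then have "q powi (3 * tri (s + 1) - 2 * (s + 1)) * q powi (3 * tri (- s) - 1 * (- s)) = q powi (1 + (3 * s\<^sup>2 + 2 * s))"
        by (simp only: power_int_add_nonzero[OF q(2), symmetric])
      also have "\<dots> = q * q powi (3 * s\<^sup>2 + 2 * s)" using q by (subst power_int_add) auto
      finally show ?thesis
        unfolding neg jtheta_cube_coeff_mod_3[OF q] jtheta_cube_coeff_minus_2[OF q] by algebra
    qed
    then show "((\<lambda>j. ?h j * ?h (- j)) \<circ> (\<lambda>s. 3 * (s + 1) - 2) has_sum q * (?h (- 1))\<^sup>2 * ?f) UNIV"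
      using has_sum_cmult_right[OF f, of "q * (?h (- 1))\<^sup>2"] by (simp add: o_def)
  qed (auto simp: inj_def)
  have "((\<lambda>j. ?h j * ?h (- j)) has_sum phi (q ^ 3) * (?h 0)\<^sup>2 + q * (?h (- 1))\<^sup>2 * ?f + q * (?h (- 1))\<^sup>2 * ?f)
      (range (\<lambda>s. 3 * s) \<union> range (\<lambda>s. 3 * (- s) - 1) \<union> range (\<lambda>s. 3 * (s + 1) - 2))"
    by (intro has_sum_Un_disjoint c0 c1 c2; auto; presburger)
  moreover have "range (\<lambda>s. 3 * s) \<union> range (\<lambda>s. 3 * (- s) - 1) \<union> range (\<lambda>s. 3 * (s + 1) - 2) = (UNIV :: int set)"
    unfolding set_eq_iff image_iff Un_iff by auto presburger
  ultimately show ?thesis using has_sum_unique[OF tot] by simp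
qed

section \<open>Product formulas\<close>

text \<open>As simplification rules these expand powers of infinite products only, leaving the
  powers of \<open>q\<close> in their arguments intact.\<close>

lemma qpochhammer_inf_powers:
  "(qpochhammer_inf a q)\<^sup>2 = qpochhammer_inf a q * qpochhammer_inf a q"
  "qpochhammer_inf a q ^ 3 = qpochhammer_inf a q * qpochhammer_inf a q * qpochhammer_inf a q"
  "qpochhammer_inf a q ^ 5 = qpochhammer_inf a q * qpochhammer_inf a q * qpochhammer_inf a q
    * qpochhammer_inf a q * qpochhammer_inf a q"
  by (simp_all add: numeral_eq_Suc)

text \<open>The triple product with \<open>v\<close> and \<open>u\<close> fixed by multiplicative
  conditions, which are easier to check than equations with \<open>inverse z\<close>.\<close>

lemma jtheta_prod:
  assumes q: "norm q < 1" "q \<noteq> 0" and z: "z * q = - v" "z * u = - 1"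
  shows "jtheta q z = euler_prod q * qpochhammer_inf v q * qpochhammer_inf u q"
proof -
  have z0: "z \<noteq> 0" using z by auto
  then have "inverse z = - u" using z(2) by (simp add: field_simps)
  then show ?thesis using jacobi_triple_product[OF q z0] z(1) by simp
qed

lemma qpochhammer_inf_uminus_self:
  assumes "norm q < 1"
  shows "qpochhammer_inf (- q) q = euler_prod (q\<^sup>2) / euler_prod q"
  using qpochhammer_inf_mult_uminus[OF assms, of q] euler_prod_nonzero[OF assms]
  by (simp add: field_simps)

text \<open>Separating odd and even exponents in \<open>qpochhammer_inf (- q) q\<close> leaves the
  wanted product times the same kind of product at \<open>q\<^sup>2\<close>.\<close>

lemma qpochhammer_inf_uminus_square:
  assumes q: "norm q < 1"
  shows "qpochhammer_inf (- q) (q\<^sup>2) = (euler_prod (q\<^sup>2))\<^sup>2 / (euler_prod q * euler_prod (q ^ 4))"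
proof -
  have n2: "norm (q\<^sup>2) < 1" using norm_power_less_1[OF q, of 2] by simp
  have "qpochhammer_inf (- q) q = qpochhammer_inf (- q) (q\<^sup>2) * qpochhammer_inf (- (q\<^sup>2)) (q\<^sup>2)"
    using qpochhammer_inf_dissect[OF q, of 2 "- q"] by (simp add: numeral_2_eq_2)
  moreover have "qpochhammer_inf (- (q\<^sup>2)) (q\<^sup>2) = euler_prod (q ^ 4) / euler_prod (q\<^sup>2)"
    using qpochhammer_inf_uminus_self[OF n2] by (simp flip: power_mult)
  ultimately show ?thesis
    using euler_prod_nonzero[OF q] euler_prod_power_nonzero[OF q, of 2] euler_prod_power_nonzero[OF q, of 4]
    by (simp add: qpochhammer_inf_uminus_self[OF q] field_simps qpochhammer_inf_powers)
qed

lemma qpochhammer_inf_dissect_3: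
  assumes q: "norm q < 1"
  shows "qpochhammer_inf a q = qpochhammer_inf a (q ^ 3) * qpochhammer_inf (a * q) (q ^ 3)
    * qpochhammer_inf (a * q\<^sup>2) (q ^ 3)"
  using qpochhammer_inf_dissect[OF q, of 3 a] by (simp add: numeral_3_eq_3 power2_eq_square mult.assoc)

text \<open>The sign survives only in the factors with odd exponent, which form
  \<open>qpochhammer_inf (- q) (q\<^sup>2)\<close>.\<close>

lemma euler_prod_uminus:
  assumes q: "norm q < 1"
  shows "euler_prod (- q) = euler_prod (q\<^sup>2) ^ 3 / (euler_prod q * euler_prod (q ^ 4))"
proof -
  have "euler_prod (- q) = qpochhammer_inf (- q) (q\<^sup>2) * euler_prod (q\<^sup>2)"
    using qpochhammer_inf_dissect[of "- q" 2 "- q"] q by (simp add: numeral_2_eq_2)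
  then show ?thesis by (simp add: qpochhammer_inf_uminus_square[OF q] qpochhammer_inf_powers)
qed

context
  fixes q :: complex
  assumes q: "norm q < 1" "q \<noteq> 0"
begin

lemma phi_prod: "phi q = euler_prod (q\<^sup>2) ^ 5 / ((euler_prod q)\<^sup>2 * (euler_prod (q ^ 4))\<^sup>2)"
proof -
  have n2: "norm (q\<^sup>2) < 1" using norm_power_less_1[OF q(1), of 2] by simp
  have "phi q = euler_prod (q\<^sup>2) * qpochhammer_inf (- q) (q\<^sup>2) * qpochhammer_inf (- q) (q\<^sup>2)"
    unfolding phi_def by (rule jtheta_prod[OF n2]) (use q in \<open>simp_all add: power_int_minus field_simps numeral_eq_Suc\<close>)
  then show ?thesis
    by (simp add: qpochhammer_inf_uminus_square[OF q(1)] power_divide power_mult_distrib field_simps qpochhammer_inf_powers)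
qed

text \<open>This value is 2\<psi>(q); the 2 is the head factor \<open>1 - (- 1)\<close>.\<close>

lemma jtheta_1_prod: "jtheta q 1 = 2 * (euler_prod (q\<^sup>2))\<^sup>2 / euler_prod q"
proof -
  have "jtheta q 1 = euler_prod q * qpochhammer_inf (- q) q * qpochhammer_inf (- 1) q"
    by (rule jtheta_prod[OF q]) simp_all
  also have "qpochhammer_inf (- 1) q = 2 * qpochhammer_inf (- q) q"
    using qpochhammer_inf_head[OF q(1), of "- 1"] by simp
  finally show ?thesis
    using euler_prod_nonzero[OF q(1)]
    by (simp add: qpochhammer_inf_uminus_self[OF q(1)] field_simps qpochhammer_inf_powers)
qed

lemma norm_cube_less_1: "norm (q ^ 3) < 1" using norm_power_less_1[OF q(1), of 3] by simp

text \<open>The triple product yields the part of \<open>qpochhammer_inf (- q) q\<close> with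
  exponents prime to 3; the remaining part is divided out.\<close>

lemma jtheta_cube_inverse_prod:
  "jtheta (q ^ 3) (q powi (- 1)) = euler_prod (q\<^sup>2) * (euler_prod (q ^ 3))\<^sup>2 / (euler_prod q * euler_prod (q ^ 6))"
proof -
  have "jtheta (q ^ 3) (q powi (- 1))
      = euler_prod (q ^ 3) * qpochhammer_inf (- (q\<^sup>2)) (q ^ 3) * qpochhammer_inf (- q) (q ^ 3)"
    by (rule jtheta_prod[OF norm_cube_less_1]) (use q in \<open>simp_all add: power_int_minus field_simps numeral_eq_Suc\<close>)
  moreover have "qpochhammer_inf (- q) q = qpochhammer_inf (- q) (q ^ 3) * qpochhammer_inf (- (q\<^sup>2)) (q ^ 3)
      * qpochhammer_inf (- (q ^ 3)) (q ^ 3)"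
    using qpochhammer_inf_dissect_3[OF q(1), of "- q"] by (simp add: power2_eq_square power3_eq_cube mult.assoc)
  moreover have "qpochhammer_inf (- (q ^ 3)) (q ^ 3) = euler_prod (q ^ 6) / euler_prod (q ^ 3)"
    using qpochhammer_inf_uminus_self[OF norm_cube_less_1] by (simp flip: power_mult)
  ultimately show ?thesis
    using euler_prod_nonzero[OF q(1)] euler_prod_power_nonzero[OF q(1), of 3] euler_prod_power_nonzero[OF q(1), of 6]
    by (simp add: qpochhammer_inf_uminus_self[OF q(1)] field_simps qpochhammer_inf_powers)
qed

text \<open>As before, but only odd exponents prime to 3 occur, so the dissection starts from
  \<open>qpochhammer_inf (- q) (q\<^sup>2)\<close>.\<close>

lemma jtheta_power_6_prod:
  "jtheta (q ^ 6) (q powi (- 1)) = (euler_prod (q\<^sup>2))\<^sup>2 * euler_prod (q ^ 3) * euler_prod (q ^ 12)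
    / (euler_prod q * euler_prod (q ^ 4) * euler_prod (q ^ 6))"
proof -
  have n2: "norm (q\<^sup>2) < 1" and n6: "norm (q ^ 6) < 1"
    using norm_power_less_1[OF q(1), of 2] norm_power_less_1[OF q(1), of 6] by auto
  have "jtheta (q ^ 6) (q powi (- 1))
      = euler_prod (q ^ 6) * qpochhammer_inf (- (q ^ 5)) (q ^ 6) * qpochhammer_inf (- q) (q ^ 6)"
    by (rule jtheta_prod[OF n6]) (use q in \<open>simp_all add: power_int_minus field_simps numeral_eq_Suc\<close>)
  moreover have "qpochhammer_inf (- q) (q\<^sup>2) = qpochhammer_inf (- q) (q ^ 6) * qpochhammer_inf (- (q ^ 3)) (q ^ 6)
      * qpochhammer_inf (- (q ^ 5)) (q ^ 6)"
    using qpochhammer_inf_dissect_3[OF n2, of "- q"] by (simp add: numeral_eq_Suc mult.assoc)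
  moreover have "qpochhammer_inf (- (q ^ 3)) (q ^ 6) = (euler_prod (q ^ 6))\<^sup>2 / (euler_prod (q ^ 3) * euler_prod (q ^ 12))"
    using qpochhammer_inf_uminus_square[OF norm_cube_less_1] by (simp flip: power_mult)
  ultimately show ?thesis
    using euler_prod_nonzero[OF q(1)] euler_prod_power_nonzero[OF q(1), of 3] euler_prod_power_nonzero[OF q(1), of 6]
      euler_prod_power_nonzero[OF q(1), of 4] euler_prod_power_nonzero[OF q(1), of 12]
    by (simp add: qpochhammer_inf_uminus_square[OF q(1)] field_simps qpochhammer_inf_powers)
qed

text \<open>The three products supplied by the triple product are the residue classes modulo 3 of
  \<open>euler_prod q\<close>; the second form exchanges two of them.\<close>

lemma pentagonal_number_theorem:
  "jtheta (q ^ 3) (- (q powi (- 1))) = euler_prod q" "jtheta (q ^ 3) (- (q powi (- 2))) = euler_prod q"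
proof -
  have *: "euler_prod q = qpochhammer_inf q (q ^ 3) * qpochhammer_inf (q\<^sup>2) (q ^ 3) * euler_prod (q ^ 3)"
    using qpochhammer_inf_dissect_3[OF q(1), of q] by (simp add: power2_eq_square power3_eq_cube mult.assoc)
  have "jtheta (q ^ 3) (- (q powi (- 1))) = euler_prod (q ^ 3) * qpochhammer_inf (q\<^sup>2) (q ^ 3) * qpochhammer_inf q (q ^ 3)"
    by (rule jtheta_prod[OF norm_cube_less_1]) (use q in \<open>simp_all add: power_int_minus field_simps numeral_eq_Suc\<close>)
  then show "jtheta (q ^ 3) (- (q powi (- 1))) = euler_prod q" unfolding * by (simp only: mult_ac)
  have "jtheta (q ^ 3) (- (q powi (- 2))) = euler_prod (q ^ 3) * qpochhammer_inf q (q ^ 3) * qpochhammer_inf (q\<^sup>2) (q ^ 3)"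
    by (rule jtheta_prod[OF norm_cube_less_1]) (use q in \<open>simp_all add: power_int_minus field_simps numeral_eq_Suc\<close>)
  then show "jtheta (q ^ 3) (- (q powi (- 2))) = euler_prod q" unfolding * by (simp only: mult_ac)
qed

lemma jtheta_cube_dissection:
  assumes z: "z \<noteq> 0"
  shows "jtheta q z ^ 3 = jtheta_cube_coeff q 0 * jtheta (q ^ 3) (z ^ 3)
    + jtheta_cube_coeff q (- 1) * (z powi (- 1) * jtheta (q ^ 3) (z ^ 3 * q powi (- 1))
    + z powi (- 2) * jtheta (q ^ 3) (z ^ 3 * q powi (- 2)))"
proof -
  let ?h = "jtheta_cube_coeff q"
  have cls: "((\<lambda>j. ?h j * z powi j) has_sum ?h (- r) * z powi (- r) * jtheta (q ^ 3) (z ^ 3 * q powi (- r)))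
      (range (\<lambda>s. 3 * s - r))" for r
  proof (subst has_sum_reindex)
    have "?h (3 * s - r) * z powi (3 * s - r)
        = ?h (- r) * z powi (- r) * ((q ^ 3) powi tri s * (z ^ 3 * q powi (- r)) powi s)" for s
    proof -
      have "q powi (3 * tri s + - r * s) = (q ^ 3) powi tri s * (q powi (- r)) powi s"
        unfolding power_int_add_nonzero[OF q(2)] power_int_power power_int_mult[symmetric] by simp
      then have "q powi (3 * tri s - r * s) = (q ^ 3) powi tri s * (q powi (- r)) powi s"
        by simp
      moreover have "z powi (- r + 3 * s) = z powi (- r) * (z ^ 3) powi s"
        unfolding power_int_add_nonzero[OF z] power_int_power by simp
      then have "z powi (3 * s - r) = z powi (- r) * (z ^ 3) powi s"
        by simp
      ultimately show ?thesis
        unfolding jtheta_cube_coeff_mod_3[OF q] power_int_mult_distrib by (simp only: mult_ac)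
    qed
    then show "((\<lambda>j. ?h j * z powi j) \<circ> (\<lambda>s. 3 * s - r) has_sum
        ?h (- r) * z powi (- r) * jtheta (q ^ 3) (z ^ 3 * q powi (- r))) UNIV"
      using has_sum_cmult_right[OF jtheta_has_sum[OF norm_cube_less_1], of "?h (- r) * z powi (- r)"] by (simp add: o_def)
  qed (auto simp: inj_def)
  have "((\<lambda>j. ?h j * z powi j) has_sum
      ?h (- 0) * z powi (- 0) * jtheta (q ^ 3) (z ^ 3 * q powi (- 0))
      + ?h (- 1) * z powi (- 1) * jtheta (q ^ 3) (z ^ 3 * q powi (- 1))
      + ?h (- 2) * z powi (- 2) * jtheta (q ^ 3) (z ^ 3 * q powi (- 2)))
      (range (\<lambda>s. 3 * s - 0) \<union> range (\<lambda>s. 3 * s - 1) \<union> range (\<lambda>s. 3 * s - 2))"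
    by (intro has_sum_Un_disjoint cls; auto; presburger)
  moreover have "range (\<lambda>s. 3 * s - 0) \<union> range (\<lambda>s. 3 * s - 1) \<union> range (\<lambda>s. 3 * s - 2) = (UNIV :: int set)"
    unfolding set_eq_iff image_iff Un_iff by auto presburger
  ultimately show ?thesis
    using has_sum_unique[OF has_sum_jtheta_cube_laurent[OF q z]]
    by (simp add: jtheta_cube_coeff_minus_2[OF q] distrib_left mult.assoc)
qed

text \<open>At \<open>z = - \<omega>\<close> with a primitive cube root of unity \<open>\<omega>\<close>, the first term of the dissection vanishes and the
  other two are instances of the pentagonal number theorem.\<close>

lemma jtheta_cube_coeff_prod: "jtheta_cube_coeff q (- 1) = 3 * euler_prod (q ^ 3) ^ 3 / euler_prod q"
proof -
  define \<omega> where "\<omega> = Complex (- 1 / 2) (sqrt 3 / 2)"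
  have w: "\<omega>\<^sup>2 + \<omega> + 1 = 0"
    by (simp add: \<omega>_def complex_eq_iff power2_eq_square field_simps)
  have w3: "\<omega> ^ 3 = 1" using w by algebra
  have w0: "\<omega> \<noteq> 0" using w3 by auto
  have inv: "inverse \<omega> = \<omega>\<^sup>2" using w3 w0 by (simp add: field_simps power3_eq_cube power2_eq_square)
  have ww: "\<omega> - \<omega>\<^sup>2 \<noteq> 0" by (simp add: \<omega>_def complex_eq_iff power2_eq_square)
  have "jtheta q (- \<omega>) = euler_prod q * qpochhammer_inf (\<omega> * q) q * qpochhammer_inf (\<omega>\<^sup>2) q"
    by (rule jtheta_prod[OF q]) (use w3 in \<open>simp_all add: power2_eq_square power3_eq_cube mult.assoc\<close>)
  \<comment> \<open>With its head removed, this product completes the triple at \<open>q\<close>,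
    \<open>\<omega> * q\<close> and \<open>\<omega>\<^sup>2 * q\<close>.\<close>
  also have "qpochhammer_inf (\<omega>\<^sup>2) q = (1 - \<omega>\<^sup>2) * qpochhammer_inf (\<omega>\<^sup>2 * q) q"
    by (rule qpochhammer_inf_head[OF q(1)])
  also have "euler_prod q * qpochhammer_inf (\<omega> * q) q * ((1 - \<omega>\<^sup>2) * qpochhammer_inf (\<omega>\<^sup>2 * q) q)
      = (1 - \<omega>\<^sup>2) * euler_prod (q ^ 3)"
    unfolding qpochhammer_inf_mult_cube_roots[OF q(1) w, symmetric] by (simp only: mult_ac)
  finally have lhs: "jtheta q (- \<omega>) = (1 - \<omega>\<^sup>2) * euler_prod (q ^ 3)" .
  have z3: "(- \<omega>) ^ 3 = - 1" using w3 by (simp add: power3_eq_cube)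
  \<comment> \<open>At this point the triple product contains the factor 1 - 1.\<close>
  have zero: "jtheta (q ^ 3) (- 1) = 0"
    using q qpochhammer_inf_head[OF norm_cube_less_1, of 1] by (subst jacobi_triple_product[OF norm_cube_less_1]) auto
  have zi: "(- \<omega>) powi (- 1) = - (\<omega>\<^sup>2)" "(- \<omega>) powi (- 2) = \<omega>"
    using inv w3 w0 by (simp_all add: power_int_minus field_simps power2_eq_square power3_eq_cube)
  have "((1 - \<omega>\<^sup>2) * euler_prod (q ^ 3)) ^ 3 = jtheta_cube_coeff q (- 1) * ((\<omega> - \<omega>\<^sup>2) * euler_prod q)"
    using jtheta_cube_dissection[of "- \<omega>"] w0
    unfolding lhs z3 zi mult_minus1 zero pentagonal_number_theorem by (simp add: algebra_simps)
  moreover have "(1 - \<omega>\<^sup>2) ^ 3 = 3 * (\<omega> - \<omega>\<^sup>2)" using w by algebra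
  ultimately have "(\<omega> - \<omega>\<^sup>2) * (3 * euler_prod (q ^ 3) ^ 3) = (\<omega> - \<omega>\<^sup>2) * (jtheta_cube_coeff q (- 1) * euler_prod q)"
    unfolding power_mult_distrib by algebra
  then have "3 * euler_prod (q ^ 3) ^ 3 = jtheta_cube_coeff q (- 1) * euler_prod q"
    using ww by (simp only: mult_left_cancel not_False_eq_True)
  then show ?thesis using euler_prod_nonzero[OF q(1)] by (simp add: field_simps)
qed

end

section \<open>Binary quadratic theta series\<close>

lemma infsum_Collect_split:
  fixes f :: "'a \<Rightarrow> complex"
  assumes "f summable_on S"
  shows "infsum f S = infsum f {x \<in> S. p x} + infsum f {x \<in> S. \<not> p x}"
proof -
  have "infsum f ({x \<in> S. p x} \<union> {x \<in> S. \<not> p x}) = infsum f {x \<in> S. p x} + infsum f {x \<in> S. \<not> p x}"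
    by (rule infsum_Un_disjoint) (auto intro: summable_on_subset_banach[OF assms])
  moreover have "{x \<in> S. p x} \<union> {x \<in> S. \<not> p x} = S" by auto
  ultimately show ?thesis by simp
qed

lemma has_sum_jtheta_cube_coeff_minus_1:
  assumes q: "norm q < 1" "q \<noteq> 0"
  shows "((\<lambda>(b, c). q powi (b * b + b * c + c * c + b + c)) has_sum jtheta_cube_coeff q (- 1)) UNIV"
proof -
  have "tri b + tri c + tri (- 1 - b - c) = b * b + b * c + c * c + b + c" for b c
    using two_tri[of b] two_tri[of c] two_tri[of "- 1 - b - c"] by (simp add: algebra_simps)
  then show ?thesis using has_sum_jtheta_cube_coeff[OF q, of "- 1"] by simp
qed

lemma has_sum_powi_times:
  fixes q :: complex
  assumes "q \<noteq> 0" "((\<lambda>m. q powi e m) has_sum A) UNIV" "((\<lambda>n. q powi d n) has_sum B) UNIV"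
  shows "((\<lambda>(m, n). q powi (e m + d n)) has_sum A * B) UNIV"
  using has_sum_times_complex[OF assms(2,3)] by (simp add: power_int_add_nonzero[OF assms(1)])

context
  fixes q :: complex
  assumes q: "norm q < 1" "q \<noteq> 0"
begin

lemma has_sum_jtheta_cube_coeff_0:
  "((\<lambda>(b, c). q powi (b * b + b * c + c * c)) has_sum jtheta_cube_coeff q 0) UNIV"
proof -
  have "tri b + tri c + tri (0 - b - c) = b * b + b * c + c * c" for b c
    using two_tri[of b] two_tri[of c] two_tri[of "0 - b - c"] by (simp add: algebra_simps)
  then show ?thesis using has_sum_jtheta_cube_coeff[OF q, of 0] by simp
qed

lemma has_sum_phi_phi: "((\<lambda>(m, n). q powi (m * m + 3 * (n * n))) has_sum phi q * phi (q ^ 3)) UNIV"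
proof (rule has_sum_powi_times[OF q(2)])
  show "((\<lambda>m. q powi (m * m)) has_sum phi q) UNIV"
    using has_sum_phi[OF q] by (simp add: power2_eq_square)
  show "((\<lambda>n. q powi (3 * (n * n))) has_sum phi (q ^ 3)) UNIV"
    using has_sum_phi[of "q ^ 3"] norm_cube_less_1[OF q] q by (simp add: power2_eq_square power_int_power)
qed

lemma has_sum_psi_psi:
  "((\<lambda>(m, n). q powi (m * m + m + 3 * (n * n + n) + 1)) has_sum q * (jtheta (q\<^sup>2) 1 * jtheta (q ^ 6) 1)) UNIV"
proof -
  have "m * m + m = int 2 * tri m + 0 * m" "3 * (m * m + m) = int 6 * tri m + 0 * m" for m
    using two_tri[of m] by (simp_all add: algebra_simps)
  then have 1: "((\<lambda>m. q powi (m * m + m)) has_sum jtheta (q\<^sup>2) (q powi 0)) UNIV"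
    and 2: "((\<lambda>m. q powi (3 * (m * m + m))) has_sum jtheta (q ^ 6) (q powi 0)) UNIV"
    by (intro has_sum_powi_tri_linear[OF q]; simp)+
  show ?thesis
    using has_sum_cmult_right[OF has_sum_powi_times[OF q(2) 1 2], of q] q
    by (simp add: power_int_add_nonzero case_prod_unfold mult_ac)
qed

text \<open>Completing the square by \<open>m = b + c div 2\<close> makes the form diagonal: even
  \<open>c\<close> gives the product of \<open>phi\<close> values, odd \<open>c\<close> the shifted
  squares.\<close>

lemma jtheta_cube_coeff_0_eq:
  "jtheta_cube_coeff q 0 = phi q * phi (q ^ 3) + q * (jtheta (q\<^sup>2) 1 * jtheta (q ^ 6) 1)"
proof -
  let ?f = "\<lambda>(b, c). q powi (b * b + b * c + c * c)"
  have "infsum ?f {x \<in> UNIV. even (snd x)} = infsum (\<lambda>(m, n). q powi (m * m + 3 * (n * n))) UNIV"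
    by (rule infsum_reindex_bij_witness[of _ "\<lambda>(m, n). (m - n, 2 * n)" "\<lambda>(b, c). (b + c div 2, c div 2)"])
       (auto elim!: evenE simp: algebra_simps)
  moreover have "infsum ?f {x \<in> UNIV. \<not> even (snd x)} = infsum (\<lambda>(m, n). q powi (m * m + m + 3 * (n * n + n) + 1)) UNIV"
    by (rule infsum_reindex_bij_witness[of _ "\<lambda>(m, n). (m - n, 2 * n + 1)" "\<lambda>(b, c). (b + c div 2, c div 2)"])
       (auto elim!: oddE simp: algebra_simps)
  ultimately show ?thesis
    using infsum_Collect_split[OF has_sum_imp_summable[OF has_sum_jtheta_cube_coeff_0], of "\<lambda>x. even (snd x)"]
      infsumI[OF has_sum_jtheta_cube_coeff_0] infsumI[OF has_sum_phi_phi] infsumI[OF has_sum_psi_psi]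
    by simp
qed

text \<open>A sum of two squares is rotated by \<open>m = i + j\<close>, \<open>n = i - j\<close>,
  with \<open>m\<close> shifted by 1 when \<open>m + n\<close> is odd.\<close>

lemma phi_square: "(phi q)\<^sup>2 = (phi (q\<^sup>2))\<^sup>2 + q * (jtheta (q ^ 4) 1)\<^sup>2"
proof -
  let ?f = "\<lambda>(m, n). q powi (m * m + n * n)"
  have phi1: "((\<lambda>m. q powi (m * m)) has_sum phi q) UNIV"
    using has_sum_phi[OF q] by (simp add: power2_eq_square)
  have hs: "(?f has_sum (phi q)\<^sup>2) UNIV"
    using has_sum_powi_times[OF q(2) phi1 phi1] by (simp add: power2_eq_square)
  have "norm (q\<^sup>2) < 1" using norm_power_less_1[OF q(1), of 2] by simp
  then have phi2: "((\<lambda>m. q powi (2 * (m * m))) has_sum phi (q\<^sup>2)) UNIV"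
    using has_sum_phi[of "q\<^sup>2"] q by (simp add: power2_eq_square[of "_ :: int"] power_int_power)
  have "2 * (m * m + m) = int 4 * tri m + 0 * m" for m
    using two_tri[of m] by (simp add: algebra_simps)
  then have psi: "((\<lambda>m. q powi (2 * (m * m + m))) has_sum jtheta (q ^ 4) (q powi 0)) UNIV"
    by (intro has_sum_powi_tri_linear[OF q]; simp)
  have psi2: "((\<lambda>(m, n). q powi (2 * (m * m + m) + 2 * (n * n + n) + 1)) has_sum q * (jtheta (q ^ 4) 1)\<^sup>2) UNIV"
    using has_sum_cmult_right[OF has_sum_powi_times[OF q(2) psi psi], of q] q
    by (simp add: power_int_add_nonzero case_prod_unfold mult_ac power2_eq_square[of "jtheta _ _"])
  have "infsum ?f {x \<in> UNIV. even (fst x + snd x)} = infsum (\<lambda>(m, n). q powi (2 * (m * m) + 2 * (n * n))) UNIV"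
    by (rule infsum_reindex_bij_witness[of _ "\<lambda>(i, j). (i + j, i - j)" "\<lambda>(m, n). ((m + n) div 2, (m + n) div 2 - n)"])
       (auto elim!: evenE simp: algebra_simps)
  moreover have "infsum ?f {x \<in> UNIV. \<not> even (fst x + snd x)}
      = infsum (\<lambda>(m, n). q powi (2 * (m * m + m) + 2 * (n * n + n) + 1)) UNIV"
    by (rule infsum_reindex_bij_witness[of _ "\<lambda>(i, j). (i + j + 1, i - j)" "\<lambda>(m, n). ((m + n) div 2, (m + n) div 2 - n)"])
       (auto elim!: oddE simp: algebra_simps)
  ultimately show ?thesis
    using infsum_Collect_split[OF has_sum_imp_summable[OF hs], of "\<lambda>x. even (fst x + snd x)"]
      infsumI[OF hs] infsumI[OF has_sum_powi_times[OF q(2) phi2 phi2]] infsumI[OF psi2]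
    by (simp add: power2_eq_square[of "phi _"])
qed

text \<open>The reflection of \<open>m\<close> to \<open>- 1 - m\<close> preserves
  \<open>tri m\<close> and exchanges the two parity classes of \<open>m - n\<close>. Both classes
  give the same form, whence the factor 2.\<close>

lemma jtheta_times_jtheta_cube:
  "jtheta q 1 * jtheta (q ^ 3) (q powi (- 1)) = 2 * infsum (\<lambda>(n, k). q powi (2 * (n * n + n * k + k * k) + n + k)) UNIV"
proof -
  let ?f = "\<lambda>(n, m). q powi (3 * tri n - n + tri m)"
  have 1: "((\<lambda>n. q powi (3 * tri n - n)) has_sum jtheta (q ^ 3) (q powi (- 1))) UNIV"
    by (rule has_sum_powi_tri_linear[OF q]) auto
  have 2: "((\<lambda>n. q powi (tri n)) has_sum jtheta q 1) UNIV"
    using has_sum_powi_tri_linear[OF q, of 1 tri 0] by simp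
  note hs = has_sum_powi_times[OF q(2) 1 2]
  have e1: "3 * tri n - n + tri (n + 2 * k) = 2 * (n * n + n * k + k * k) + n + k" for n k
    using two_tri[of n] two_tri[of "n + 2 * k"] by (simp add: algebra_simps)
  have e2: "3 * tri n - n + tri (- 1 - n - 2 * k) = 2 * (n * n + n * k + k * k) + n + k" for n k
    using two_tri[of n] two_tri[of "- 1 - n - 2 * k"] by (simp add: algebra_simps)
  have "infsum (\<lambda>(n, k). q powi (2 * (n * n + n * k + k * k) + n + k)) UNIV = infsum ?f {x \<in> UNIV. even (snd x - fst x)}"
    by (rule infsum_reindex_bij_witness[of _ "\<lambda>(n, m). (n, (m - n) div 2)" "\<lambda>(n, k). (n, n + 2 * k)"])
       (auto simp: e1)
  moreover have "infsum (\<lambda>(n, k). q powi (2 * (n * n + n * k + k * k) + n + k)) UNIV = infsum ?f {x \<in> UNIV. \<not> even (snd x - fst x)}"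
    by (rule infsum_reindex_bij_witness[of _ "\<lambda>(n, m). (n, (- 1 - m - n) div 2)" "\<lambda>(n, k). (n, - 1 - n - 2 * k)"])
       (auto simp: e2)
  ultimately show ?thesis
    using infsum_Collect_split[OF has_sum_imp_summable[OF hs], of "\<lambda>x. even (snd x - fst x)"]
      infsumI[OF hs] by (simp add: mult.commute)
qed

text \<open>The exponent is symmetric in \<open>b\<close>, \<open>c\<close> and \<open>- 1 - b - c\<close>, which are either all odd or odd exactly once; the
  three classes of the second kind therefore contribute equally.\<close>

lemma jtheta_cube_coeff_minus_1_dissection:
  "jtheta_cube_coeff q (- 1)
    = 3 * infsum (\<lambda>(n, k). (q\<^sup>2) powi (2 * (n * n + n * k + k * k) + n + k)) UNIV + q * jtheta_cube_coeff (q ^ 4) (- 1)"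
proof -
  let ?f = "\<lambda>(b, c). q powi (b * b + b * c + c * c + b + c)"
  let ?g = "\<lambda>(n, k). (q\<^sup>2) powi (2 * (n * n + n * k + k * k) + n + k)"
  have p2: "(q\<^sup>2) powi e = q powi (2 * e)" for e by (simp add: power_int_power)
  note hs = has_sum_jtheta_cube_coeff_minus_1[OF q]
  have sm: "?f summable_on S" for S using summable_on_subset_banach[OF has_sum_imp_summable[OF hs]] by auto
  have ee: "infsum ?f {x \<in> {x \<in> UNIV. even (fst x)}. even (snd x)} = infsum ?g UNIV"
    by (rule infsum_reindex_bij_witness[of _ "\<lambda>(i, j). (2 * i, 2 * j)" "\<lambda>(b, c). (b div 2, c div 2)"])
       (auto elim!: evenE simp: p2 algebra_simps)
  have eo: "infsum ?f {x \<in> {x \<in> UNIV. even (fst x)}. \<not> even (snd x)} = infsum ?g UNIV"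
    by (rule infsum_reindex_bij_witness[of _ "\<lambda>(i, j). (2 * i, - 1 - 2 * i - 2 * j)" "\<lambda>(b, c). (b div 2, (- 1 - b - c) div 2)"])
       (auto elim!: evenE oddE simp: p2 algebra_simps, presburger)
  have oe: "infsum ?f {x \<in> {x \<in> UNIV. \<not> even (fst x)}. even (snd x)} = infsum ?g UNIV"
    by (rule infsum_reindex_bij_witness[of _ "\<lambda>(i, j). (- 1 - 2 * i - 2 * j, 2 * i)" "\<lambda>(b, c). (c div 2, (- 1 - b - c) div 2)"])
       (auto elim!: evenE oddE simp: p2 algebra_simps, presburger)
  have n4: "norm (q ^ 4) < 1" using norm_power_less_1[OF q(1), of 4] by simp
  from has_sum_cmult_right[OF has_sum_jtheta_cube_coeff_minus_1[OF n4], of q]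
  have h4: "((\<lambda>(b, c). q powi (4 * (b * b + b * c + c * c + b + c) + 1)) has_sum q * jtheta_cube_coeff (q ^ 4) (- 1)) UNIV"
    using q by (simp add: power_int_add_nonzero case_prod_unfold mult_ac power_int_power)
  \<comment> \<open>Writing \<open>b = - 2 * i - 1\<close> and \<open>c = - 2 * j - 1\<close>
    reproduces the original form, scaled by 4 and raised by 1.\<close>
  have oo: "infsum ?f {x \<in> {x \<in> UNIV. \<not> even (fst x)}. \<not> even (snd x)}
      = infsum (\<lambda>(b, c). q powi (4 * (b * b + b * c + c * c + b + c) + 1)) UNIV"
    by (rule infsum_reindex_bij_witness[of _ "\<lambda>(i, j). (- 2 * i - 1, - 2 * j - 1)" "\<lambda>(b, c). ((- 1 - b) div 2, (- 1 - c) div 2)"])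
       (auto elim!: oddE simp: algebra_simps)
  show ?thesis
    using infsum_Collect_split[OF sm, of UNIV "\<lambda>x. even (fst x)"]
      infsum_Collect_split[OF sm, of "{x \<in> UNIV. even (fst x)}" "\<lambda>x. even (snd x)"]
      infsum_Collect_split[OF sm, of "{x \<in> UNIV. \<not> even (fst x)}" "\<lambda>x. even (snd x)"]
    unfolding ee eo oe oo infsumI[OF hs] infsumI[OF h4] by (simp add: algebra_simps)
qed

end

text \<open>The exponent \<open>m * m + 3 * (n * n)\<close> has the parity of \<open>m + n\<close>,
  so passing to \<open>- q\<close> negates exactly the odd class and the difference is twice that
  class. Each parity class of the series on the right is a reparametrisation of it, so the right
  side is also \<open>2 * ?o\<close>.\<close>

lemma phi_phi_minus:
  assumes q: "norm q < 1" "q \<noteq> 0"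
  shows "phi q * phi (q ^ 3) - phi (- q) * phi ((- q) ^ 3) = q * (jtheta (q\<^sup>2) 1 * jtheta (q ^ 6) 1)"
proof -
  have mq: "norm (- q) < 1" "- q \<noteq> 0" using q by auto
  let ?f = "\<lambda>q (m, n). q powi (m * m + 3 * (n * n)) :: complex"
  let ?g = "\<lambda>(m, n). q powi (m * m + m + 3 * (n * n + n) + 1)"
  let ?o = "infsum (\<lambda>(j, x). q powi (4 * (j * j + j * x + x * x) + 4 * j + 2 * x + 1)) UNIV"
  let ?e = "infsum (\<lambda>(j, x). q powi (4 * (j * j + j * x + x * x))) UNIV"
  have pe: "p powi (4 * e) = q powi (4 * e)" if "p = q \<or> p = - q" for p e
    using that by (auto simp: power_int_minus_left)
  have po: "(- q) powi (4 * e + 4 * a + 2 * b + 1) = - (q powi (4 * e + 4 * a + 2 * b + 1))" for e a b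
    by (simp add: power_int_minus_left)
  have e1: "infsum (?f p) {x \<in> UNIV. even (fst x + snd x)} = ?e" if "p = q \<or> p = - q" for p
  proof -
    have "infsum (\<lambda>(j, x). p powi (4 * (j * j + j * x + x * x))) UNIV = infsum (?f p) {x \<in> UNIV. even (fst x + snd x)}"
      by (rule infsum_reindex_bij_witness[of _ "\<lambda>(m, n). (n, (m - n) div 2)" "\<lambda>(j, x). (j + 2 * x, j)"])
         (auto simp: algebra_simps)
    then show ?thesis by (simp only: pe[OF that])
  qed
  have o1: "infsum (?f p) {x \<in> UNIV. \<not> even (fst x + snd x)}
      = infsum (\<lambda>(j, x). p powi (4 * (j * j + j * x + x * x) + 4 * j + 2 * x + 1)) UNIV" for p
    by (rule sym, rule infsum_reindex_bij_witness[of _ "\<lambda>(m, n). ((m - n) div 2, n)" "\<lambda>(j, x). (x + 2 * j + 1, x)"])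
       (auto simp: algebra_simps, (presburger+)?)
  have "infsum (\<lambda>(j, x). (- q) powi (4 * (j * j + j * x + x * x) + 4 * j + 2 * x + 1)) UNIV = - ?o"
    unfolding po by (simp add: case_prod_unfold infsum_uminus)
  then have "phi q * phi (q ^ 3) - phi (- q) * phi ((- q) ^ 3) = 2 * ?o"
    using infsum_Collect_split[OF has_sum_imp_summable[OF has_sum_phi_phi[OF q]], of "\<lambda>x. even (fst x + snd x)"]
      infsum_Collect_split[OF has_sum_imp_summable[OF has_sum_phi_phi[OF mq]], of "\<lambda>x. even (fst x + snd x)"]
    unfolding e1[OF disjI1[OF refl]] e1[OF disjI2[OF refl]] o1 infsumI[OF has_sum_phi_phi[OF q]] infsumI[OF has_sum_phi_phi[OF mq]]
    by simp
  moreover have "infsum ?g {x \<in> UNIV. even (fst x - snd x)} = ?o"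
    by (rule sym, rule infsum_reindex_bij_witness[of _ "\<lambda>(m, n). (n, (m - n) div 2)" "\<lambda>(j, x). (j + 2 * x, j)"])
       (auto simp: algebra_simps, (presburger+)?)
  moreover have "infsum ?g {x \<in> UNIV. \<not> even (fst x - snd x)} = ?o"
    by (rule sym, rule infsum_reindex_bij_witness[of _ "\<lambda>(m, n). (n, (- 1 - m - n) div 2)" "\<lambda>(j, x). (- 1 - j - 2 * x, j)"])
       (auto simp: algebra_simps, (presburger+)?)
  ultimately show ?thesis
    using infsum_Collect_split[OF has_sum_imp_summable[OF has_sum_psi_psi[OF q]], of "\<lambda>x. even (fst x - snd x)"]
      infsumI[OF has_sum_psi_psi[OF q]] by simp
qed

section \<open>The algebraic identity\<close>

lemma cubic_parametrization:
  fixes C D P R :: complex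
  assumes nz: "C \<noteq> 0" "D \<noteq> 0" "C + D \<noteq> 0" "C - D \<noteq> 0"
    and 1: "(C - D) * R - (C + D) * P = 4 * C * D"
    and 3: "(C - D) ^ 3 * R - (C + D) ^ 3 * P = 16 * C * D ^ 3"
  shows "P = C - 3 * D" "R = C + 3 * D"
proof -
  \<comment> \<open>\<open>R\<close> is eliminated by subtracting \<open>(C - D)\<^sup>2\<close>
    times the first equation from the second.\<close>
  have "(4 * C * D * (C + D)) * (P - (C - 3 * D)) = 0" using 1 3 by algebra
  then show P: "P = C - 3 * D" using nz by simp
  have "(C - D) * (R - (C + 3 * D)) = 0" using 1 P by algebra
  then show "R = C + 3 * D" using nz by simp
qed

text \<open>The variables stand for \<open>e\<^sub>n = E\<^sub>n\<close> and for the values \<open>m\<^sub>1\<close>, \<open>m\<^sub>3\<close> of \<open>E\<^sub>1\<close>, \<open>E\<^sub>3\<close> at \<open>- q\<close>.\<close>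

lemma eta_quotient_identity:
  fixes q e1 e2 e3 e4 e6 e12 m1 m3 :: complex
  assumes nz [simp]: "q \<noteq> 0" "e1 \<noteq> 0" "e2 \<noteq> 0" "e3 \<noteq> 0" "e4 \<noteq> 0" "e6 \<noteq> 0" "e12 \<noteq> 0"
    and m1: "m1 = e2 ^ 3 / (e1 * e4)" and m3: "m3 = e6 ^ 3 / (e3 * e12)"
    and d1: "e3 ^ 3 / e1 = e4 ^ 3 * e6\<^sup>2 / (e2\<^sup>2 * e12) + q * e12 ^ 3 / e4"
    and d2: "m3 ^ 3 / m1 = e4 ^ 3 * e6\<^sup>2 / (e2\<^sup>2 * e12) - q * e12 ^ 3 / e4"
    and leg: "(m1 * m3)\<^sup>2 / (e2 * e6) - (e1 * e3)\<^sup>2 / (e2 * e6) = 4 * q * e4\<^sup>2 * e12\<^sup>2 / (e2 * e6)"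
    and jac: "(m3\<^sup>2 / e6) ^ 4 - (e3\<^sup>2 / e6) ^ 4 = 16 * q ^ 3 * e12 ^ 8 / e6 ^ 4"
  shows "(m1\<^sup>2 / e2) * (m3\<^sup>2 / e6 * ((m1 * m3)\<^sup>2 / (e2 * e6) + 4 * q * e4\<^sup>2 * e12\<^sup>2 / (e2 * e6))\<^sup>2
      + 18 * q * (e3 ^ 3 / e1)\<^sup>2 * (e2\<^sup>2 * e3 * e12 / (e1 * e4 * e6)))
    = 4 / 9 * (e1 ^ 9 / e3 ^ 3) - 1 / 3 * (e2 ^ 9 / e6 ^ 3) + 8 / 9 * (e4 ^ 9 / e12 ^ 3)
      + 36 * (q * e3 ^ 9 / e1 ^ 3) + 27 * (q\<^sup>2 * e6 ^ 9 / e2 ^ 3) + 72 * (q ^ 4 * e12 ^ 9 / e4 ^ 3)"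
proof -
  \<comment> \<open>Here \<open>P\<close> and \<open>R\<close> are the values of E_1^3 / E_3 at
    \<open>q\<close> and \<open>- q\<close>, while \<open>C\<close> is even in \<open>q\<close> and
    \<open>D\<close> is odd. The scale factors \<open>r\<close>, \<open>k\<close> and
    \<open>s\<close> are split off so that only polynomials in \<open>C\<close>, \<open>D\<close>,
    \<open>P\<close> and \<open>R\<close> remain.\<close>
  define C D r k P R s where "C = e4 ^ 3 / e12" and "D = q * e2\<^sup>2 * e12 ^ 3 / (e4 * e6\<^sup>2)"
    and "r = e6\<^sup>2 / e2\<^sup>2" and "k = e6 / e2 ^ 3" and "P = e1 ^ 3 / e3" and "R = m1 ^ 3 / m3"
    and "s = q * r ^ 3"
  note defs = C_def D_def r_def k_def P_def R_def s_def
  have mnz [simp]: "m1 \<noteq> 0" "m3 \<noteq> 0" by (simp_all add: m1 m3)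
  have [simp]: "r \<noteq> 0" "k \<noteq> 0" "C \<noteq> 0" "D \<noteq> 0" "P \<noteq> 0" "R \<noteq> 0" by (simp_all add: defs)
  have f1: "e3 ^ 3 / e1 = r * (C + D)" unfolding d1 defs by (simp add: divide_simps, algebra?)
  have f2: "m3 ^ 3 / m1 = r * (C - D)" unfolding d2 defs by (simp add: divide_simps, algebra?)
  have cd: "C + D \<noteq> 0" "C - D \<noteq> 0" using f1 f2 by auto
  have g1: "(m1 * m3)\<^sup>2 / (e2 * e6) = k * (R * (C - D))"
  proof -
    have "k * (R * (C - D)) * r = k * R * (m3 ^ 3 / m1)" unfolding f2 by (simp only: mult_ac)
    also have "\<dots> = (m1 * m3)\<^sup>2 / (e2 * e6) * r" unfolding defs by (simp add: divide_simps, algebra?)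
    finally show ?thesis using \<open>r \<noteq> 0\<close> mult_right_cancel by metis
  qed
  have g2: "(e1 * e3)\<^sup>2 / (e2 * e6) = k * (P * (C + D))"
  proof -
    have "k * (P * (C + D)) * r = k * P * (e3 ^ 3 / e1)" unfolding f1 by (simp only: mult_ac)
    also have "\<dots> = (e1 * e3)\<^sup>2 / (e2 * e6) * r" unfolding defs by (simp add: divide_simps, algebra?)
    finally show ?thesis using \<open>r \<noteq> 0\<close> mult_right_cancel by metis
  qed
  have g3: "4 * q * e4\<^sup>2 * e12\<^sup>2 / (e2 * e6) = k * (4 * C * D)"
    unfolding defs by (simp add: divide_simps, algebra?)
  have "k * ((C - D) * R - (C + D) * P) = k * (4 * C * D)"
    using leg unfolding g1 g2 g3 by (simp add: algebra_simps)
  then have L1: "(C - D) * R - (C + D) * P = 4 * C * D" by simp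
  \<comment> \<open>Multiplying the cube of \<open>m3 ^ 3 / m1\<close> by
    \<open>R = m1 ^ 3 / m3\<close> cancels \<open>m1\<close> and leaves \<open>m3 ^ 8\<close>. In
    this way the quartic identity becomes linear in \<open>P\<close> and \<open>R\<close>.\<close>
  have "r ^ 3 * ((C - D) ^ 3 * R - (C + D) ^ 3 * P) = (m3 ^ 3 / m1) ^ 3 * R - (e3 ^ 3 / e1) ^ 3 * P"
    unfolding f1 f2 by algebra
  also have "\<dots> = m3 ^ 8 - e3 ^ 8" unfolding R_def P_def by (simp add: divide_simps, algebra?)
  also have "\<dots> = 16 * q ^ 3 * e12 ^ 8"
    using jac by (simp add: divide_simps power_mult_distrib flip: power_mult)
  also have "\<dots> = r ^ 3 * (16 * C * D ^ 3)" unfolding defs by (simp add: divide_simps, algebra?)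
  finally have L3: "(C - D) ^ 3 * R - (C + D) ^ 3 * P = 16 * C * D ^ 3" by simp
  note PR = cubic_parametrization[OF \<open>C \<noteq> 0\<close> \<open>D \<noteq> 0\<close> cd L1 L3]
  let ?W = "C * ((C - 3 * D) * (C + 3 * D))"
  have b1: "e1 ^ 9 / e3 ^ 3 = (C - 3 * D) ^ 3"
    unfolding PR(1)[symmetric] P_def by (simp add: power_divide flip: power_mult)
  have b4: "e4 ^ 9 / e12 ^ 3 = C ^ 3"
    unfolding C_def by (simp add: power_divide flip: power_mult)
  have b2: "e2 ^ 9 / e6 ^ 3 = ?W"
    unfolding PR(1,2)[symmetric] unfolding defs m1 m3 by (simp add: divide_simps, algebra?)
  have c1: "q * e3 ^ 9 / e1 ^ 3 = s * (C + D) ^ 3"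
  proof -
    have "q * e3 ^ 9 / e1 ^ 3 = q * (e3 ^ 3 / e1) ^ 3" by (simp add: power_divide flip: power_mult)
    then show ?thesis unfolding f1 s_def by (simp add: power_mult_distrib)
  qed
  have c4: "q ^ 4 * e12 ^ 9 / e4 ^ 3 = s * D ^ 3"
    unfolding defs by (simp add: divide_simps, algebra?)
  have c2: "q\<^sup>2 * e6 ^ 9 / e2 ^ 3 = s * (D * ((C + D) * (C - D)))"
  proof -
    have "s * (D * ((C + D) * (C - D))) = q * r * D * ((e3 ^ 3 / e1) * (m3 ^ 3 / m1))"
      unfolding f1 f2 s_def by algebra
    also have "\<dots> = q\<^sup>2 * e6 ^ 9 / e2 ^ 3" unfolding defs m1 m3 by (simp add: divide_simps, algebra?)
    finally show ?thesis by simp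
  qed
  have k3: "k ^ 3 * ?W = 1" unfolding b2[symmetric] k_def by (simp add: power_divide flip: power_mult)
  \<comment> \<open>Both sides are compared after multiplication by \<open>s\<close>, where each
    equals \<open>q\<^sup>2 * e6 ^ 9 / e2 ^ 3\<close>.\<close>
  have sW: "s * ?W = D * ((C + D) * (C - D))"
  proof -
    have "s * (s * ?W) = s * (e2 ^ 9 / e6 ^ 3) * s" unfolding b2 by simp
    also have "\<dots> = q\<^sup>2 * e6 ^ 9 / e2 ^ 3" unfolding defs by (simp add: divide_simps, algebra?)
    finally show ?thesis unfolding c2 by (simp add: s_def)
  qed
  have W0: "?W \<noteq> 0" using k3 by auto
  have t1: "(m1\<^sup>2 / e2) * (m3\<^sup>2 / e6) = k * (R * (C - D))"
    unfolding g1[symmetric] by (simp add: power_mult_distrib)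
  have t2: "(m1\<^sup>2 / e2) * (q * (e2\<^sup>2 * e3 * e12 / (e1 * e4 * e6))) * r\<^sup>2 = s * R"
    unfolding defs m1 m3 by (simp add: divide_simps, algebra?)
  let ?lhs = "(m1\<^sup>2 / e2) * (m3\<^sup>2 / e6 * ((m1 * m3)\<^sup>2 / (e2 * e6) + 4 * q * e4\<^sup>2 * e12\<^sup>2 / (e2 * e6))\<^sup>2
      + 18 * q * (e3 ^ 3 / e1)\<^sup>2 * (e2\<^sup>2 * e3 * e12 / (e1 * e4 * e6)))"
  have "?lhs = ((m1\<^sup>2 / e2) * (m3\<^sup>2 / e6)) * ((m1 * m3)\<^sup>2 / (e2 * e6) + 4 * q * e4\<^sup>2 * e12\<^sup>2 / (e2 * e6))\<^sup>2
      + 18 * ((m1\<^sup>2 / e2) * (q * (e2\<^sup>2 * e3 * e12 / (e1 * e4 * e6))) * (e3 ^ 3 / e1)\<^sup>2)"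
    by (simp only: distrib_left mult_ac)
  also have "\<dots> = k * (R * (C - D)) * (k * (R * (C - D)) + k * (4 * C * D))\<^sup>2
      + 18 * ((m1\<^sup>2 / e2) * (q * (e2\<^sup>2 * e3 * e12 / (e1 * e4 * e6))) * (r * (C + D))\<^sup>2)"
    unfolding t1 g1 g3 f1 ..
  also have "\<dots> = k ^ 3 * (R * (C - D) * (R * (C - D) + 4 * C * D)\<^sup>2)
      + 18 * ((m1\<^sup>2 / e2) * (q * (e2\<^sup>2 * e3 * e12 / (e1 * e4 * e6))) * r\<^sup>2) * (C + D)\<^sup>2"
    by algebra
  also have "\<dots> = k ^ 3 * (R * (C - D) * (R * (C - D) + 4 * C * D)\<^sup>2) + 18 * (s * R) * (C + D)\<^sup>2"
    unfolding t2 ..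
  finally have lhs: "?lhs = k ^ 3 * (R * (C - D) * (R * (C - D) + 4 * C * D)\<^sup>2) + 18 * (s * R) * (C + D)\<^sup>2" .
  \<comment> \<open>Multiplication by \<open>?W\<close> removes the scale factors, since
    \<open>k3\<close> and \<open>sW\<close> express \<open>k ^ 3 * ?W\<close> and
    \<open>s * ?W\<close> through \<open>C\<close> and \<open>D\<close>. What is left is a
    polynomial identity.\<close>
  have "?W * (9 * (k ^ 3 * (R * (C - D) * (R * (C - D) + 4 * C * D)\<^sup>2) + 18 * (s * R) * (C + D)\<^sup>2))
      = ?W * (4 * (C - 3 * D) ^ 3 - 3 * ?W + 8 * C ^ 3 + 9 * (36 * (s * (C + D) ^ 3)
        + 27 * (s * (D * ((C + D) * (C - D)))) + 72 * (s * D ^ 3)))"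
    using k3 sW unfolding PR(2) by algebra
  then have "9 * (k ^ 3 * (R * (C - D) * (R * (C - D) + 4 * C * D)\<^sup>2) + 18 * (s * R) * (C + D)\<^sup>2)
      = 4 * (C - 3 * D) ^ 3 - 3 * ?W + 8 * C ^ 3 + 9 * (36 * (s * (C + D) ^ 3)
        + 27 * (s * (D * ((C + D) * (C - D)))) + 72 * (s * D ^ 3))"
    using mult_left_cancel[OF W0] by (rule iffD1[rotated])
  then show ?thesis
    unfolding lhs b1 b2 b4 c1 c2 c4 by (simp add: field_simps)
qed

section \<open>The generating function\<close>

text \<open>In this form the value at \<open>- q\<close> is immediate, because
  \<open>q\<^sup>2\<close> does not change.\<close>

lemma phi_eq_euler_prod:
  assumes q: "norm q < 1" "q \<noteq> 0"
  shows "phi q = (euler_prod (- q))\<^sup>2 / euler_prod (q\<^sup>2)"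
  using euler_prod_nonzero[OF q(1)] euler_prod_power_nonzero[OF q(1), of 2] euler_prod_power_nonzero[OF q(1), of 4]
  unfolding phi_prod[OF q] euler_prod_uminus[OF q(1)]
  by (simp add: power_divide power_mult_distrib divide_simps flip: power_mult power_Suc2)

lemma phi_uminus:
  assumes q: "norm q < 1" "q \<noteq> 0"
  shows "phi (- q) = (euler_prod q)\<^sup>2 / euler_prod (q\<^sup>2)"
  using phi_eq_euler_prod[of "- q"] q by simp

text \<open>By \<open>phi_square\<close> the squares at \<open>q\<close> and \<open>- q\<close> are
  \<open>A\<^sup>2 + q * B\<^sup>2\<close> and \<open>A\<^sup>2 - q * B\<^sup>2\<close>, so the
  fourth powers differ by \<open>4 * q * (A * B)\<^sup>2\<close>. In \<open>A * B\<close> the Euler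
  product at \<open>q ^ 8\<close> cancels.\<close>

lemma jacobi_quartic:
  assumes q: "norm q < 1" "q \<noteq> 0"
  shows "phi q ^ 4 - phi (- q) ^ 4 = 16 * q * euler_prod (q ^ 4) ^ 8 / euler_prod (q\<^sup>2) ^ 4"
proof -
  have q2: "norm (q\<^sup>2) < 1" "q\<^sup>2 \<noteq> 0" and q4: "norm (q ^ 4) < 1" "q ^ 4 \<noteq> 0"
    using norm_power_less_1[OF q(1), of 2] norm_power_less_1[OF q(1), of 4] q by auto
  define A B where "A = phi (q\<^sup>2)" and "B = jtheta (q ^ 4) 1"
  have A: "A = euler_prod (q ^ 4) ^ 5 / ((euler_prod (q\<^sup>2))\<^sup>2 * (euler_prod (q ^ 8))\<^sup>2)"
    using phi_prod[OF q2] by (simp add: A_def flip: power_mult)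
  have B: "B = 2 * (euler_prod (q ^ 8))\<^sup>2 / euler_prod (q ^ 4)"
    using jtheta_1_prod[OF q4] by (simp add: B_def flip: power_mult)
  have AB: "A * B = 2 * euler_prod (q ^ 4) ^ 4 / (euler_prod (q\<^sup>2))\<^sup>2"
    unfolding A B using euler_prod_power_nonzero[OF q(1), of 2] euler_prod_power_nonzero[OF q(1), of 4]
      euler_prod_power_nonzero[OF q(1), of 8]
    by (simp add: divide_simps, algebra?)
  have 1: "(phi q)\<^sup>2 = A\<^sup>2 + q * B\<^sup>2" using phi_square[OF q] by (simp add: A_def B_def)
  have 2: "(phi (- q))\<^sup>2 = A\<^sup>2 - q * B\<^sup>2" using phi_square[of "- q"] q by (simp add: A_def B_def)
  have "phi q ^ 4 - phi (- q) ^ 4 = 4 * q * (A * B)\<^sup>2" using 1 2 by algebra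
  then show ?thesis unfolding AB by (simp add: power_divide power_mult_distrib flip: power_mult)
qed

text \<open>The parity dissection of L(q) in product form: \<open>2 * ?S\<close> is a product of two
  theta values at \<open>q\<^sup>2\<close>, and the all-odd class is \<open>q\<close> times L at
  \<open>q ^ 4\<close>.\<close>

lemma euler_prod_cubic_dissection:
  assumes q: "norm q < 1" "q \<noteq> 0"
  shows "euler_prod (q ^ 3) ^ 3 / euler_prod q = euler_prod (q ^ 4) ^ 3 * (euler_prod (q ^ 6))\<^sup>2
      / ((euler_prod (q\<^sup>2))\<^sup>2 * euler_prod (q ^ 12)) + q * euler_prod (q ^ 12) ^ 3 / euler_prod (q ^ 4)"
proof -
  have q2: "norm (q\<^sup>2) < 1" "q\<^sup>2 \<noteq> 0" and q4: "norm (q ^ 4) < 1" "q ^ 4 \<noteq> 0"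
    using norm_power_less_1[OF q(1), of 2] norm_power_less_1[OF q(1), of 4] q by auto
  let ?S = "infsum (\<lambda>(n, k). (q\<^sup>2) powi (2 * (n * n + n * k + k * k) + n + k)) UNIV"
  have "2 * ?S = (2 * (euler_prod (q ^ 4))\<^sup>2 / euler_prod (q\<^sup>2))
      * (euler_prod (q ^ 4) * (euler_prod (q ^ 6))\<^sup>2 / (euler_prod (q\<^sup>2) * euler_prod (q ^ 12)))"
    unfolding jtheta_times_jtheta_cube[OF q2, symmetric] jtheta_1_prod[OF q2] jtheta_cube_inverse_prod[OF q2]
    by (simp flip: power_mult)
  also have "\<dots> = 2 * (euler_prod (q ^ 4) ^ 3 * (euler_prod (q ^ 6))\<^sup>2 / ((euler_prod (q\<^sup>2))\<^sup>2 * euler_prod (q ^ 12)))"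
    by (simp add: power2_eq_square[of "euler_prod _"] power3_eq_cube[of "euler_prod _"] mult_ac)
  finally have S: "?S = euler_prod (q ^ 4) ^ 3 * (euler_prod (q ^ 6))\<^sup>2 / ((euler_prod (q\<^sup>2))\<^sup>2 * euler_prod (q ^ 12))"
    by (simp only: mult_left_cancel zero_neq_numeral[symmetric] not_False_eq_True)
  have "3 * (euler_prod (q ^ 3) ^ 3 / euler_prod q) = 3 * (?S + q * euler_prod (q ^ 12) ^ 3 / euler_prod (q ^ 4))"
    using jtheta_cube_coeff_minus_1_dissection[OF q] jtheta_cube_coeff_prod[OF q] jtheta_cube_coeff_prod[OF q4]
    by (simp flip: power_mult)
  then show ?thesis
    unfolding S by (simp only: mult_left_cancel zero_neq_numeral[symmetric] not_False_eq_True)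
qed

theorem theorem6p2:
  fixes q :: complex
  assumes "norm q < 1"
  shows "summable (\<lambda>n. of_nat (cphi 6 n) * q ^ n) \<and>
    CPhi 6 q =
        4 / 9 * (euler_prod q ^ 5 * euler_prod (q ^ 4) ^ 2
               / (euler_prod (q ^ 2) ^ 5 * euler_prod (q ^ 3) ^ 3))
      - 1 / 3 * (euler_prod (q ^ 2) ^ 4 * euler_prod (q ^ 4) ^ 2
               / (euler_prod q ^ 4 * euler_prod (q ^ 6) ^ 3))
      + 8 / 9 * (euler_prod (q ^ 4) ^ 11
               / (euler_prod q ^ 4 * euler_prod (q ^ 2) ^ 5 * euler_prod (q ^ 12) ^ 3))
      + 36 * q * (euler_prod (q ^ 4) ^ 2 * euler_prod (q ^ 3) ^ 9
               / (euler_prod q ^ 7 * euler_prod (q ^ 2) ^ 5))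
      + 27 * q ^ 2 * (euler_prod (q ^ 4) ^ 2 * euler_prod (q ^ 6) ^ 9
               / (euler_prod q ^ 4 * euler_prod (q ^ 2) ^ 8))
      + 72 * q ^ 4 * (euler_prod (q ^ 12) ^ 9
               / (euler_prod q ^ 4 * euler_prod (q ^ 2) ^ 5 * euler_prod (q ^ 4)))"
proof (intro conjI)
  show "summable (\<lambda>n. of_nat (cphi 6 n) * q ^ n)"
    using CPhi_sums[OF assms] by (rule sums_summable)
  define e1 e2 e3 e4 e6 e12 where "e1 = euler_prod q" and "e2 = euler_prod (q\<^sup>2)" and "e3 = euler_prod (q ^ 3)"
    and "e4 = euler_prod (q ^ 4)" and "e6 = euler_prod (q ^ 6)" and "e12 = euler_prod (q ^ 12)"
  define m1 m3 where "m1 = euler_prod (- q)" and "m3 = euler_prod (- (q ^ 3))"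
  note folds = e1_def[symmetric] e2_def[symmetric] e3_def[symmetric] e4_def[symmetric] e6_def[symmetric]
    e12_def[symmetric] m1_def[symmetric] m3_def[symmetric]
  have "CPhi 6 q = 4 / 9 * (e1 ^ 5 * e4\<^sup>2 / (e2 ^ 5 * e3 ^ 3)) - 1 / 3 * (e2 ^ 4 * e4\<^sup>2 / (e1 ^ 4 * e6 ^ 3))
      + 8 / 9 * (e4 ^ 11 / (e1 ^ 4 * e2 ^ 5 * e12 ^ 3)) + 36 * q * (e4\<^sup>2 * e3 ^ 9 / (e1 ^ 7 * e2 ^ 5))
      + 27 * q\<^sup>2 * (e4\<^sup>2 * e6 ^ 9 / (e1 ^ 4 * e2 ^ 8)) + 72 * q ^ 4 * (e12 ^ 9 / (e1 ^ 4 * e2 ^ 5 * e4))"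
  proof (cases "q = 0")
    \<comment> \<open>The theta arguments involve negative powers of \<open>q\<close>, so the origin
      is checked directly.\<close>
    case True
    have "euler_prod 0 = 1" by (simp add: qpochhammer_inf_def)
    then have "e1 = 1" "e2 = 1" "e3 = 1" "e4 = 1" "e6 = 1" "e12 = 1"
      by (simp_all add: True e1_def e2_def e3_def e4_def e6_def e12_def)
    moreover have "CPhi 6 q = 1" unfolding CPhi_def True powser_zero by (simp add: cphi_0)
    ultimately show ?thesis using True by simp
  next
    case False
    note q = assms False
    have q2: "norm (q\<^sup>2) < 1" "q\<^sup>2 \<noteq> 0" and q3: "norm (q ^ 3) < 1" "q ^ 3 \<noteq> 0" and q6: "norm (q ^ 6) < 1" "q ^ 6 \<noteq> 0"
      and mq: "norm (- q) < 1" "- q \<noteq> 0"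
      using norm_power_less_1[OF q(1), of 2] norm_power_less_1[OF q(1), of 3] norm_power_less_1[OF q(1), of 6] q by auto
    have nz: "e1 \<noteq> 0" "e2 \<noteq> 0" "e3 \<noteq> 0" "e4 \<noteq> 0" "e6 \<noteq> 0" "e12 \<noteq> 0"
      unfolding e1_def e2_def e3_def e4_def e6_def e12_def
      by (intro euler_prod_nonzero euler_prod_power_nonzero q(1); simp)+
    have m1: "m1 = e2 ^ 3 / (e1 * e4)"
      using euler_prod_uminus[OF q(1)] unfolding folds .
    have m3: "m3 = e6 ^ 3 / (e3 * e12)"
      using euler_prod_uminus[OF q3(1)] by (simp add: folds flip: power_mult)
    have d1: "e3 ^ 3 / e1 = e4 ^ 3 * e6\<^sup>2 / (e2\<^sup>2 * e12) + q * e12 ^ 3 / e4"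
      using euler_prod_cubic_dissection[OF q] unfolding folds .
    have d2: "m3 ^ 3 / m1 = e4 ^ 3 * e6\<^sup>2 / (e2\<^sup>2 * e12) - q * e12 ^ 3 / e4"
      using euler_prod_cubic_dissection[OF mq] by (simp add: folds)
    have phi: "phi q = m1\<^sup>2 / e2" "phi (- q) = e1\<^sup>2 / e2" "phi (q ^ 3) = m3\<^sup>2 / e6" "phi (- (q ^ 3)) = e3\<^sup>2 / e6"
      using phi_eq_euler_prod[OF q] phi_uminus[OF q] phi_eq_euler_prod[OF q3] phi_uminus[OF q3]
      by (simp_all add: folds flip: power_mult)
    have psi: "jtheta (q\<^sup>2) 1 = 2 * e4\<^sup>2 / e2" "jtheta (q ^ 6) 1 = 2 * e12\<^sup>2 / e6"
      using jtheta_1_prod[OF q2] jtheta_1_prod[OF q6] by (simp_all add: folds flip: power_mult)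
    have psi_psi: "q * (jtheta (q\<^sup>2) 1 * jtheta (q ^ 6) 1) = 4 * q * e4\<^sup>2 * e12\<^sup>2 / (e2 * e6)"
      unfolding psi by simp
    have leg: "(m1 * m3)\<^sup>2 / (e2 * e6) - (e1 * e3)\<^sup>2 / (e2 * e6) = 4 * q * e4\<^sup>2 * e12\<^sup>2 / (e2 * e6)"
      using phi_phi_minus[OF q] unfolding psi_psi by (simp add: phi power_mult_distrib)
    have jac: "(m3\<^sup>2 / e6) ^ 4 - (e3\<^sup>2 / e6) ^ 4 = 16 * q ^ 3 * e12 ^ 8 / e6 ^ 4"
      using jacobi_quartic[OF q3] by (simp add: phi folds flip: power_mult)
    have a: "jtheta_cube_coeff q 0 = (m1 * m3)\<^sup>2 / (e2 * e6) + 4 * q * e4\<^sup>2 * e12\<^sup>2 / (e2 * e6)"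
      unfolding jtheta_cube_coeff_0_eq[OF q] psi_psi phi by (simp add: power_mult_distrib)
    have "e1 ^ 6 * CPhi 6 q = m3\<^sup>2 / e6 * ((m1 * m3)\<^sup>2 / (e2 * e6) + 4 * q * e4\<^sup>2 * e12\<^sup>2 / (e2 * e6))\<^sup>2
        + 18 * q * (e3 ^ 3 / e1)\<^sup>2 * (e2\<^sup>2 * e3 * e12 / (e1 * e4 * e6))"
      using CPhi_6_theta[OF q]
      unfolding a phi jtheta_cube_coeff_prod[OF q] jtheta_power_6_prod[OF q] folds
      by (simp add: power_divide power_mult_distrib)
    with eta_quotient_identity[OF False nz m1 m3 d1 d2 leg jac]
    have S: "(m1\<^sup>2 / e2) * (e1 ^ 6 * CPhi 6 q) = 4 / 9 * (e1 ^ 9 / e3 ^ 3) - 1 / 3 * (e2 ^ 9 / e6 ^ 3)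
        + 8 / 9 * (e4 ^ 9 / e12 ^ 3) + 36 * (q * e3 ^ 9 / e1 ^ 3) + 27 * (q\<^sup>2 * e6 ^ 9 / e2 ^ 3)
        + 72 * (q ^ 4 * e12 ^ 9 / e4 ^ 3)"
      by simp
    \<comment> \<open>This is the reciprocal of \<open>phi q * e1 ^ 6\<close>, since
      \<open>phi q = m1\<^sup>2 / e2 = e2 ^ 5 / (e1\<^sup>2 * e4\<^sup>2)\<close>.\<close>
    define c where "c = e4\<^sup>2 / (e1 ^ 4 * e2 ^ 5)"
    have "CPhi 6 q = ((m1\<^sup>2 / e2) * (e1 ^ 6 * CPhi 6 q)) * c"
      unfolding m1 c_def using nz by (simp add: divide_simps power_mult_distrib power_divide flip: power_mult, algebra?)
    also have "\<dots> = 4 / 9 * (e1 ^ 9 / e3 ^ 3 * c) - 1 / 3 * (e2 ^ 9 / e6 ^ 3 * c)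
        + 8 / 9 * (e4 ^ 9 / e12 ^ 3 * c) + 36 * q * (e3 ^ 9 / e1 ^ 3 * c) + 27 * q\<^sup>2 * (e6 ^ 9 / e2 ^ 3 * c)
        + 72 * q ^ 4 * (e12 ^ 9 / e4 ^ 3 * c)"
      unfolding S by (simp add: algebra_simps)
    also have "e1 ^ 9 / e3 ^ 3 * c = e1 ^ 5 * e4\<^sup>2 / (e2 ^ 5 * e3 ^ 3)"
      unfolding c_def using nz by (simp add: divide_simps, algebra?)
    also have "e2 ^ 9 / e6 ^ 3 * c = e2 ^ 4 * e4\<^sup>2 / (e1 ^ 4 * e6 ^ 3)"
      unfolding c_def using nz by (simp add: divide_simps, algebra?)
    also have "e4 ^ 9 / e12 ^ 3 * c = e4 ^ 11 / (e1 ^ 4 * e2 ^ 5 * e12 ^ 3)"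
      unfolding c_def using nz by (simp add: divide_simps, algebra?)
    also have "e3 ^ 9 / e1 ^ 3 * c = e4\<^sup>2 * e3 ^ 9 / (e1 ^ 7 * e2 ^ 5)"
      unfolding c_def using nz by (simp add: divide_simps, algebra?)
    also have "e6 ^ 9 / e2 ^ 3 * c = e4\<^sup>2 * e6 ^ 9 / (e1 ^ 4 * e2 ^ 8)"
      unfolding c_def using nz by (simp add: divide_simps, algebra?)
    also have "e12 ^ 9 / e4 ^ 3 * c = e12 ^ 9 / (e1 ^ 4 * e2 ^ 5 * e4)"
      unfolding c_def using nz by (simp add: divide_simps, algebra?)
    finally show ?thesis .
  qed
  then show "CPhi 6 q =
        4 / 9 * (euler_prod q ^ 5 * euler_prod (q ^ 4) ^ 2
               / (euler_prod (q ^ 2) ^ 5 * euler_prod (q ^ 3) ^ 3))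
      - 1 / 3 * (euler_prod (q ^ 2) ^ 4 * euler_prod (q ^ 4) ^ 2
               / (euler_prod q ^ 4 * euler_prod (q ^ 6) ^ 3))
      + 8 / 9 * (euler_prod (q ^ 4) ^ 11
               / (euler_prod q ^ 4 * euler_prod (q ^ 2) ^ 5 * euler_prod (q ^ 12) ^ 3))
      + 36 * q * (euler_prod (q ^ 4) ^ 2 * euler_prod (q ^ 3) ^ 9
               / (euler_prod q ^ 7 * euler_prod (q ^ 2) ^ 5))
      + 27 * q ^ 2 * (euler_prod (q ^ 4) ^ 2 * euler_prod (q ^ 6) ^ 9
               / (euler_prod q ^ 4 * euler_prod (q ^ 2) ^ 8))
      + 72 * q ^ 4 * (euler_prod (q ^ 12) ^ 9
               / (euler_prod q ^ 4 * euler_prod (q ^ 2) ^ 5 * euler_prod (q ^ 4)))"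
    unfolding e1_def e2_def e3_def e4_def e6_def e12_def .
qed

end
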